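(* Let $U=[0,+\infty)$ or $U=[0,T]$ with $T>0$. Let $f^0,f^1\in P'$ have Walsh representations $\sum_{n=0}^\infty p_n\mathrm w_n$ and $\sum_{n=0}^\infty q_n\mathrm w_n$ respectively, and consider the Cauchy problem $$\frac{\partial^2f(x,t)}{\partial t^2}=f^{[2]}_{x^2}(x,t),\qquad f(x,0)=f^0(x),\quad f'_t(x,0)=f^1(x),\qquad x\in G,\ t\in U,$$ where $f^{[2]}_{x^2}$ denotes the second Gibbs derivative with respect to $x$. Then: 1. The Cauchy problem has a unique solution $f(x,t)$ which is in $P'$ for every $t\in U$. 2. This solution is in $C^P$ (for every $t\in U$) whenever $$p_n=O(e^{-n\theta(n)}),\quad q_n=O(e^{-n\theta(n)}),\qquad n\to\infty,\qquad ( ** )$$ where $\theta(n)\to\infty$ as $n\to\infty$. 3. This solution is in $L_2^P$ (for every $t\in U$) whenever $( ** )$ holds true.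
   Context: $\mathbb Z_+$ = non-negative integers. The Cantor dyadic group $G$ is the set of sequences $x=(x_k)_{k\in\mathbb Z}$, $x_k\in\{0,1\}$, such that $x_k=0$ for all $k$ below some index depending on $x$, with coordinatewise addition modulo 2, denoted $\oplus$; $\mathbf 0$ is the zero sequence. For $x\ne\mathbf 0$ let $N(x)$ be the least $k$ with $x_k=1$ and put $\|x\|=2^{-N(x)-1}$; $\|\mathbf 0\|=0$. The metric is $d(x,y)=\|x\oplus y\|$; $I_n=\{x:\|x\|<2^{-n}\}=\{x: x_k=0\ \forall k<n\}$, $I=I_0$. $dx$ is the Haar measure with $\int_I dx=1$. Let $\lambda(x)=\sum_{j}x_j2^{-j-1}$; restricted to the elements of $G$ that are not eventually equal to 1 (as $k\to+\infty$), $\lambda$ is a bijection onto $[0,\infty)$, and $\lambda^{-1}$ denotes its inverse. For $f:G\to\mathbb C$ and $h\ge0$: $f_{0,h}(x)=f(x\oplus\lambda^{-1}(h))$. A function $f$ on $G$ is 1-periodic if $f(x\oplus\lambda^{-1}(n))=f(x)$ for all $x\in G$, $n\in\mathbb Z_+$. $C^P$ is the space of 1-periodic continuous functions; $L_2^P$ is the space of 1-periodic functions whose restriction to $I$ is in $L_2(I)$. Walsh functions: $\mathrm w_n(x)=(-1)^{\sum_{k\in\mathbb Z}t_kx_{-k-1}}$ with $t=\lambda^{-1}(n)$, $n\in\mathbb Z_+$; they form an orthonormal basis of $L_2^P$. The Gibbs derivative of a function is $f^{[1]}(x)=\lim_{n\to\infty}\sum_{j=-n}^n2^{j-1}(f(x)-f_{0,2^{-j-1}}(x))$,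 with $f^{[n+1]}=(f^{[n]})^{[1]}$; one has $\mathrm w_n^{[1]}=n\mathrm w_n$. $P$ is the space of 1-periodic locally constant functions (equivalently, of Walsh polynomials, i.e. finite linear combinations of the $\mathrm w_k$); a sequence in $P$ converges to $0$ if all its members are constant on every ball of one common fixed radius and it tends to zero uniformly on $I$. $P'$ is the space of continuous linear functionals $f:\phi\mapsto\langle f,\phi\rangle$ on $P$; $f\in P'$ is identified with its Walsh representation, the formal series $\sum_{k=0}^\infty a_k\mathrm w_k$, $a_k=\langle f,\mathrm w_k\rangle$. For $f\in P'$, $f^{[k]}\in P'$ is defined by $\langle f^{[k]},\phi\rangle=\langle f,\phi^{[k]}\rangle$, $\phi\in P$. A 1-periodic function $f$ integrable on $I$ is regarded as an element of $P'$ via $\langle f,\phi\rangle=\int_If\phi\,dx$; "a distribution is in $L_2^P$ (or $C^P$)" means that it is given by such a function. Derivatives in the real variable $t$ of a $P'$-valued function $t\mapsto f(\cdot,t)$ are understood weakly, i.e. coefficientwise: writing $f(\cdot,t)=\sum_nc_n(t)\mathrm w_n$, the derivatives $\partial f/\partial t$, $\partial^2f/\partial t^2$ have Walsh coefficients $\dot c_n(t)$, $\ddot c_n(t)$ (one-sided at endpoints of $U$). *)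

theory Defs
  imports "HOL-Analysis.Analysis" "HOL-Library.Landau_Symbols"
begin

section \<open>The Cantor dyadic group\<close>

typedef dyadic = "{x :: int \<Rightarrow> bool. \<exists>m. \<forall>k<m. \<not> x k}"
  morphisms coord Abs_dyadic
  by (rule exI[of _ "\<lambda>_. False"]) simp

setup_lifting type_definition_dyadic

lemma dyadic_eq_iff: "x = y \<longleftrightarrow> (\<forall>k. coord x k = coord y k)"
  by (simp flip: coord_inject add: fun_eq_iff)

lemma coord_bounded_below: "\<exists>m. \<forall>k<m. \<not> coord x k"
  using coord[of x] by simp

instantiation dyadic :: ab_group_add
begin

lift_definition zero_dyadic :: dyadic is "\<lambda>_. False"
  by simp

text \<open>With \<^typ>\<open>bool\<close> for the digits 0 and 1, addition modulo 2 is exclusive or.\<close>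

lift_definition plus_dyadic :: "dyadic \<Rightarrow> dyadic \<Rightarrow> dyadic" is "\<lambda>x y k. x k \<noteq> y k"
proof -
  fix x y :: "int \<Rightarrow> bool"
  assume "\<exists>m. \<forall>k<m. \<not> x k" "\<exists>m. \<forall>k<m. \<not> y k"
  then obtain m n where "\<forall>k<m. \<not> x k" "\<forall>k<n. \<not> y k"
    by blast
  then show "\<exists>m. \<forall>k<m. \<not> (x k \<noteq> y k)"
    by (intro exI[of _ "min m n"]) auto
qed

definition uminus_dyadic :: "dyadic \<Rightarrow> dyadic" where
  "uminus_dyadic x = x"

definition minus_dyadic :: "dyadic \<Rightarrow> dyadic \<Rightarrow> dyadic" where
  "minus_dyadic x y = x + y"

instance
  by standard (auto simp: uminus_dyadic_def minus_dyadic_def dyadic_eq_iff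
      plus_dyadic.rep_eq zero_dyadic.rep_eq)

end

lemma coord_0 [simp]: "\<not> coord 0 k"
  by (simp add: zero_dyadic.rep_eq)

lemma coord_plus [simp]: "coord (x + y) k \<longleftrightarrow> coord x k \<noteq> coord y k"
  by (simp add: plus_dyadic.rep_eq)

lemma dyadic_add_self [simp]: "x + x = (0 :: dyadic)"
  by (simp add: dyadic_eq_iff)

definition first_one :: "dyadic \<Rightarrow> int" where
  "first_one x = (LEAST k. coord x k)"

definition gnorm :: "dyadic \<Rightarrow> real" where
  "gnorm x = (if x = 0 then 0 else 2 powi (- first_one x - 1))"

lemma first_one_props:
  assumes "coord x k"
  shows "coord x (first_one x)" "first_one x \<le> k" "\<And>j. j < first_one x \<Longrightarrow> \<not> coord x j"
proof -
  obtain m where m: "\<forall>k<m. \<not> coord x k"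
    using coord_bounded_below by blast
  define i where "i = (LEAST i. coord x (m + int i))"
  have "m \<le> k"
    using m assms by (meson not_le)
  then have k: "coord x (m + int (nat (k - m)))"
    using assms by simp
  have i: "coord x (m + int i)"
    unfolding i_def by (rule LeastI[where P = "\<lambda>i. coord x (m + int i)", OF k])
  have least: "m + int i \<le> j" if j: "coord x j" for j
  proof -
    have "m \<le> j"
      using m j by (meson not_le)
    then have "i \<le> nat (j - m)"
      unfolding i_def using j by (intro Least_le) simp
    then show ?thesis
      using \<open>m \<le> j\<close> by linarith
  qed
  have *: "first_one x = m + int i"
    unfolding first_one_def by (rule Least_equality) (use i least in auto)
  show "coord x (first_one x)" "first_one x \<le> k" "\<And>j. j < first_one x \<Longrightarrow> \<not> coord x j"
    using * i least assms by force+
qed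

lemma gnorm_ge: "coord x k \<Longrightarrow> 2 powi (- k - 1) \<le> gnorm x"
  using first_one_props[of x k] by (auto simp: gnorm_def intro!: power_int_increasing)

lemma gnorm_less_iff: "gnorm x < 2 powi (- n) \<longleftrightarrow> (\<forall>k<n. \<not> coord x k)"
proof
  assume *: "gnorm x < 2 powi (- n)"
  show "\<forall>k<n. \<not> coord x k"
  proof (intro allI impI notI)
    fix k assume "k < n" "coord x k"
    then have "(2::real) powi (- n) \<le> 2 powi (- k - 1)"
      by (intro power_int_increasing) auto
    also have "\<dots> \<le> gnorm x"
      by (rule gnorm_ge) fact
    finally show False
      using * by simp
  qed
next
  assume *: "\<forall>k<n. \<not> coord x k"
  show "gnorm x < 2 powi (- n)"
  proof (cases "x = 0")
    case False
    then obtain k where "coord x k"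
      by (auto simp: dyadic_eq_iff)
    then have "n \<le> first_one x"
      using first_one_props(1) * by (meson not_le)
    then have "(2::real) powi (- first_one x - 1) < 2 powi (- n)"
      by (intro power_int_strict_increasing) auto
    then show ?thesis
      using False by (simp add: gnorm_def)
  qed (simp add: gnorm_def)
qed

lemma gnorm_nonneg: "gnorm x \<ge> 0"
  by (simp add: gnorm_def)

lemma gnorm_eq_0_iff [simp]: "gnorm x = 0 \<longleftrightarrow> x = 0"
  by (simp add: gnorm_def)

lemma gnorm_ultrametric: "gnorm (x + y) \<le> max (gnorm x) (gnorm y)"
proof (cases "x + y = 0")
  case True
  then show ?thesis
    using gnorm_nonneg[of x] by (simp add: gnorm_def)
next
  case False
  then obtain k where "coord (x + y) k"
    by (meson dyadic_eq_iff coord_0)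
  then have "coord (x + y) (first_one (x + y))"
    by (rule first_one_props)
  then have "coord x (first_one (x + y)) \<or> coord y (first_one (x + y))"
    by auto
  then show ?thesis
    using gnorm_ge False by (fastforce simp: gnorm_def le_max_iff_disj)
qed

instantiation dyadic :: metric_space
begin

definition dist_dyadic :: "dyadic \<Rightarrow> dyadic \<Rightarrow> real" where
  "dist_dyadic x y = gnorm (x + y)"

definition uniformity_dyadic :: "(dyadic \<times> dyadic) filter" where
  "uniformity_dyadic = (INF e\<in>{0 <..}. principal {(x, y). dist x y < e})"

definition open_dyadic :: "dyadic set \<Rightarrow> bool" where
  "open_dyadic S = (\<forall>x\<in>S. \<forall>\<^sub>F (x', y) in uniformity. x' = x \<longrightarrow> y \<in> S)"

instance
proof
  fix x y z :: dyadic
  show "dist x y = 0 \<longleftrightarrow> x = y"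
    by (simp add: dist_dyadic_def) (auto simp: dyadic_eq_iff)
  have "x + y = (x + z) + (y + z)"
    by (auto simp: dyadic_eq_iff)
  then have "gnorm (x + y) \<le> max (gnorm (x + z)) (gnorm (y + z))"
    using gnorm_ultrametric by metis
  then show "dist x y \<le> dist x z + dist y z"
    using gnorm_nonneg[of "x + z"] gnorm_nonneg[of "y + z"] by (simp add: dist_dyadic_def)
qed (simp_all only: uniformity_dyadic_def open_dyadic_def)

end

definition I_ball :: "int \<Rightarrow> dyadic set" where
  "I_ball n = {x. gnorm x < 2 powi (- n)}"

abbreviation I_unit :: "dyadic set" where
  "I_unit \<equiv> I_ball 0"

section \<open>Haar measure\<close>

definition normalized_haar :: "dyadic measure \<Rightarrow> bool" where
  "normalized_haar \<mu> \<longleftrightarrow> sets \<mu> = sets borel \<and>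
     (\<forall>a. distr \<mu> borel (\<lambda>x. a + x) = \<mu>) \<and> emeasure \<mu> I_unit = 1"

text \<open>Existence and uniqueness are proved below, as \<open>normalized_haar_unique_existence\<close>.\<close>

definition haar :: "dyadic measure" where
  "haar = (THE \<mu>. normalized_haar \<mu>)"

definition cyl :: "int \<Rightarrow> dyadic \<Rightarrow> dyadic set" where
  "cyl n a = {x. \<forall>k<n. coord x k = coord a k}"

lemma I_ball_eq_cyl: "I_ball n = cyl n 0"
  by (auto simp: I_ball_def cyl_def gnorm_less_iff)

lemma cyl_iff_dist: "x \<in> cyl n a \<longleftrightarrow> dist x a < 2 powi (- n)"
  by (simp add: dist_dyadic_def gnorm_less_iff cyl_def)

lemma cyl_eq_ball: "cyl n a = ball a (2 powi (- n))"
  by (auto simp: cyl_iff_dist dist_commute)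

lemma open_cyl: "open (cyl n a)"
  by (simp add: cyl_eq_ball)

definition cyls :: "dyadic set set" where
  "cyls = insert {} {cyl n a | n a. True}"

lemma countable_cyls: "countable cyls"
proof -
  have "{cyl n a | n a. True}
      \<subseteq> (\<lambda>(n, S). {x. \<forall>k<n. coord x k = (k \<in> S)}) ` (UNIV \<times> Collect finite)"
  proof clarify
    fix n a
    obtain m where m: "\<forall>k<m. \<not> coord a k"
      using coord_bounded_below by blast
    let ?S = "{k. k < n \<and> coord a k}"
    have "?S \<subseteq> {m..<n}"
      using m by (auto simp: not_less[symmetric])
    then have "finite ?S"
      by (rule finite_subset) simp
    moreover have "cyl n a = {x. \<forall>k<n. coord x k = (k \<in> ?S)}"
      by (auto simp: cyl_def)
    ultimately show "cyl n a \<in> (\<lambda>(n, S). {x. \<forall>k<n. coord x k = (k \<in> S)}) ` (UNIV \<times> Collect finite)"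
      by (intro image_eqI[of _ _ "(n, ?S)"]) auto
  qed
  moreover have "countable ((UNIV :: int set) \<times> (Collect finite :: int set set))"
    by (intro countable_SIGMA countable_Collect_finite) auto
  ultimately have "countable {cyl n a | n a. True}"
    by (rule countable_subset[OF _ countable_image])
  then show ?thesis
    unfolding cyls_def by (rule countable_insert)
qed

lemma cyl_cong: "x \<in> cyl n a \<Longrightarrow> cyl n a = cyl n x"
  by (auto simp: cyl_def)

lemma Int_stable_cyls: "Int_stable cyls"
proof (rule Int_stableI)
  fix A B
  assume AB: "A \<in> cyls" "B \<in> cyls"
  show "A \<inter> B \<in> cyls"
  proof (cases "A \<inter> B = {}")
    case True
    then show ?thesis
      by (simp add: cyls_def)
  next
    case False
    then obtain x where x: "x \<in> A" "x \<in> B"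
      by blast
    have "\<exists>k. C = cyl k x" if C: "C \<in> cyls" "x \<in> C" for C
    proof -
      obtain k b where "C = cyl k b"
        using C by (auto simp: cyls_def)
      then show ?thesis
        using cyl_cong C(2) by blast
    qed
    then obtain m n where "A = cyl m x" "B = cyl n x"
      using AB x by blast
    moreover have "cyl m x \<inter> cyl n x = cyl (max m n) x"
      by (auto simp: cyl_def less_max_iff_disj)
    ultimately have "A \<inter> B = cyl (max m n) x"
      by simp
    then show ?thesis
      by (auto simp: cyls_def)
  qed
qed

lemma open_cyls: "X \<in> cyls \<Longrightarrow> open X"
  by (auto simp: cyls_def open_cyl)

lemma exists_two_powi_less:
  assumes "e > (0::real)"
  shows "\<exists>n. 2 powi (- int n) < e"
proof -
  obtain n where "(1/2) ^ n < e"
    using real_arch_pow_inv[OF assms, of "1/2"] by auto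
  then show ?thesis
    by (intro exI[of _ n]) (simp add: power_int_minus power_one_over inverse_eq_divide)
qed

lemma borel_eq_cyls: "(borel :: dyadic measure) = sigma UNIV cyls"
proof (rule borel_eq_countable_basis[OF countable_cyls])
  show "topological_basis cyls"
  proof (rule topological_basisI)
    fix O' :: "dyadic set" and x
    assume "open O'" "x \<in> O'"
    then obtain e where e: "e > 0" "ball x e \<subseteq> O'"
      using open_contains_ball by blast
    obtain n where "2 powi (- int n) < e"
      using exists_two_powi_less[OF e(1)] by blast
    then have "cyl (int n) x \<subseteq> O'"
      using e by (force simp: cyl_eq_ball)
    then show "\<exists>B'\<in>cyls. x \<in> B' \<and> B' \<subseteq> O'"
      by (intro bexI[of _ "cyl (int n) x"]) (auto simp: cyls_def cyl_def)
  qed (rule open_cyls)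
qed

lemma sets_borel_cyls: "sets (borel :: dyadic measure) = sigma_sets UNIV cyls"
  by (simp add: borel_eq_cyls)

lemma dyadic_measure_eqI:
  assumes "sets M = sets borel" "sets N = sets borel"
    and "\<And>n a. emeasure M (cyl n a) = ennreal (2 powi (- n))"
    and "\<And>n a. emeasure N (cyl n a) = ennreal (2 powi (- n))"
  shows "M = N"
proof (rule measure_eqI_generator_eq_countable[where E = cyls and \<Omega> = UNIV and A = "range (cyl 0)"])
  show "countable (range (cyl 0))"
    by (rule countable_subset[OF _ countable_cyls]) (auto simp: cyls_def)
  show "\<Union> (range (cyl 0)) = UNIV"
    by (auto simp: cyl_def)
qed (use assms Int_stable_cyls in \<open>auto simp: sets_borel_cyls cyls_def\<close>)

lemma translate_vimage_cyl: "(\<lambda>x. b + x) -` cyl n a = cyl n (a + b)"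
  by (auto simp: cyl_def)

lemma measurable_translate [measurable]: "(\<lambda>x. b + x) \<in> borel_measurable (borel :: dyadic measure)"
proof -
  have "dist (b + x) (b + y) = dist x y" for x y
  proof -
    have "(b + x) + (b + y) = x + y"
      by (auto simp: dyadic_eq_iff)
    then show ?thesis
      by (simp only: dist_dyadic_def)
  qed
  then have "continuous_on UNIV (\<lambda>x. b + x)"
    by (auto simp: continuous_on_iff)
  then show ?thesis
    by (rule borel_measurable_continuous_onI)
qed

lemma cyl_add1_iff: "x \<in> cyl (k + 1) a \<longleftrightarrow> x \<in> cyl k a \<and> coord x k = coord a k"
  unfolding cyl_def zless_add1_eq by blast

lemma two_powi_double: "(2::real) powi (- k) = 2 * 2 powi (- (k + 1))"
  using power_int_add_1'[of "2::real" "- (k + 1)"] by simp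

lemma normalized_haar_cyl:
  assumes "normalized_haar \<mu>"
  shows "emeasure \<mu> (cyl n a) = ennreal (2 powi (- n))"
proof -
  have [measurable_cong]: "sets \<mu> = sets borel" and inv: "distr \<mu> borel (\<lambda>x. b + x) = \<mu>"
    and one: "emeasure \<mu> (cyl 0 0) = 1" for b
    using assms by (auto simp: normalized_haar_def I_ball_eq_cyl)
  have [simp]: "space \<mu> = UNIV"
    using sets_eq_imp_space_eq[OF \<open>sets \<mu> = sets borel\<close>] by simp
  have [measurable]: "cyl k b \<in> sets \<mu>" for k b
    using open_cyl \<open>sets \<mu> = sets borel\<close> by simp
  have trans: "emeasure \<mu> (cyl k b) = emeasure \<mu> (cyl k 0)" for k b
  proof -
    have "emeasure \<mu> (cyl k b) = emeasure (distr \<mu> borel (\<lambda>x. b + x)) (cyl k b)"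
      by (simp add: inv)
    also have "\<dots> = emeasure \<mu> (cyl k 0)"
      by (subst emeasure_distr) (auto simp: translate_vimage_cyl open_cyl)
    finally show ?thesis .
  qed
  have double: "emeasure \<mu> (cyl k 0) = 2 * emeasure \<mu> (cyl (k + 1) 0)" for k
  proof -
    define e where "e = Abs_dyadic (\<lambda>j. j = k)"
    have e: "coord e j \<longleftrightarrow> j = k" for j
      unfolding e_def by (subst Abs_dyadic_inverse) (auto intro: exI[of _ k])
    have "cyl (k + 1) 0 \<inter> cyl (k + 1) e = {}"
      by (auto simp: cyl_def e)
    moreover have "x \<in> cyl k 0 \<longleftrightarrow> x \<in> cyl (k + 1) 0 \<or> x \<in> cyl (k + 1) e" for x
    proof -
      have "cyl k e = cyl k 0"
        by (simp add: cyl_def e)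
      then show ?thesis
        by (auto simp: cyl_add1_iff e)
    qed
    then have "cyl k 0 = cyl (k + 1) 0 \<union> cyl (k + 1) e"
      by blast
    ultimately have "emeasure \<mu> (cyl k 0) = emeasure \<mu> (cyl (k + 1) 0) + emeasure \<mu> (cyl (k + 1) e)"
      by (simp add: plus_emeasure)
    then show ?thesis
      by (simp add: trans[of _ e] mult_2)
  qed
  have "emeasure \<mu> (cyl n 0) = ennreal (2 powi (- n))"
  proof (induction n rule: int_induct[of _ 0])
    case (step1 i)
    have "ennreal 2 * emeasure \<mu> (cyl (i + 1) 0) = ennreal (2 powi (- i))"
      unfolding step1(2)[symmetric] double[of i] by simp
    also have "\<dots> = ennreal 2 * ennreal (2 powi (- (i + 1)))"
      unfolding two_powi_double[of i] by (rule ennreal_mult) simp_all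
    finally show ?case
      by (subst (asm) ennreal_mult_cancel_left) simp
  next
    case (step2 i)
    have "emeasure \<mu> (cyl (i - 1) 0) = ennreal 2 * ennreal (2 powi (- i))"
      using double[of "i - 1"] step2(2) by simp
    also have "\<dots> = ennreal (2 powi (- (i - 1)))"
      unfolding two_powi_double[of "i - 1"] by (simp add: ennreal_mult)
    finally show ?case .
  qed (simp add: one)
  then show ?thesis
    by (simp add: trans[of n a])
qed

text \<open>Existence: the image of Lebesgue measure on \<open>[0, \<infinity>)\<close> under binary expansion.\<close>

definition bin_digits :: "real \<Rightarrow> dyadic" where
  "bin_digits h = Abs_dyadic (\<lambda>k. odd \<lfloor>\<bar>h\<bar> * 2 powi (k + 1)\<rfloor>)"

lemma coord_bin_digits: "h \<ge> 0 \<Longrightarrow> coord (bin_digits h) k \<longleftrightarrow> odd \<lfloor>h * 2 powi (k + 1)\<rfloor>"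
proof -
  assume h: "h \<ge> 0"
  obtain m :: nat where m: "h < 2 ^ m"
    using real_arch_pow[of 2 h] by auto
  have "\<not> odd \<lfloor>\<bar>h\<bar> * 2 powi (j + 1)\<rfloor>" if "j < - int m" for j
  proof -
    have "h * 2 powi (j + 1) \<le> h * 2 powi (- int m)"
      using that h by (intro mult_left_mono power_int_increasing) auto
    also have "\<dots> < 1"
      using m by (simp add: power_int_minus flip: divide_inverse)
    finally have "\<lfloor>\<bar>h\<bar> * 2 powi (j + 1)\<rfloor> = 0"
      using h by (simp add: floor_eq_iff)
    then show ?thesis
      by simp
  qed
  then have "\<exists>m. \<forall>j<m. \<not> odd \<lfloor>\<bar>h\<bar> * 2 powi (j + 1)\<rfloor>"
    by blast
  then have "coord (bin_digits h) = (\<lambda>k. odd \<lfloor>\<bar>h\<bar> * 2 powi (k + 1)\<rfloor>)"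
    unfolding bin_digits_def by (intro Abs_dyadic_inverse) (rule CollectI)
  then show ?thesis
    using h by (simp only: abs_of_nonneg)
qed

lemma bin_digits_low:
  assumes "h \<ge> 0"
  shows "(\<forall>k<n. \<not> coord (bin_digits h) k) \<longleftrightarrow> \<lfloor>h * 2 powi n\<rfloor> = 0"
proof
  assume *: "\<forall>k<n. \<not> coord (bin_digits h) k"
  show "\<lfloor>h * 2 powi n\<rfloor> = 0"
  proof (rule ccontr)
    assume "\<lfloor>h * 2 powi n\<rfloor> \<noteq> 0"
    then have ge: "h * 2 powi n \<ge> 1"
      using assms by (simp add: floor_eq_iff)
    then have pos: "h > 0"
      using assms by (metis less_eq_real_def mult_zero_left not_one_le_zero)
    define l where "l = \<lfloor>log 2 h\<rfloor>"
    have "2 powr of_int l \<le> 2 powr log 2 h" "2 powr log 2 h < 2 powr of_int (l + 1)"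
      using floor_correct[of "log 2 h"] unfolding l_def by (simp_all del: powr_log_cancel)
    then have 1: "2 powi l \<le> h" "h < 2 powi (l + 1)"
      using pos by (simp_all del: of_int_add add: powr_real_of_int')
    have "h * 2 powi (- l) \<ge> 2 powi l * 2 powi (- l)"
      using 1 by (intro mult_right_mono) auto
    moreover have "h * 2 powi (- l) < 2 powi (l + 1) * 2 powi (- l)"
      using 1 by (intro mult_strict_right_mono) auto
    ultimately have "\<lfloor>h * 2 powi (- l)\<rfloor> = 1"
      by (simp add: floor_eq_iff flip: power_int_add)
    then have "coord (bin_digits h) (- l - 1)"
      using assms by (simp add: coord_bin_digits)
    moreover have "- l - 1 < n"
    proof (rule ccontr)
      assume "\<not> - l - 1 < n"
      then have "h * 2 powi n \<le> h * 2 powi (- l - 1)"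
        using assms by (intro mult_left_mono power_int_increasing) auto
      also have "\<dots> < 2 powi (l + 1) * 2 powi (- l - 1)"
        using 1 by (intro mult_strict_right_mono) auto
      also have "\<dots> = 1"
        by (simp flip: power_int_add)
      finally show False
        using ge by simp
    qed
    ultimately show False
      using * by blast
  qed
next
  assume *: "\<lfloor>h * 2 powi n\<rfloor> = 0"
  show "\<forall>k<n. \<not> coord (bin_digits h) k"
  proof (intro allI impI)
    fix k assume "k < n"
    then have "h * 2 powi (k + 1) \<le> h * 2 powi n"
      using assms by (intro mult_left_mono power_int_increasing) auto
    then have "\<lfloor>h * 2 powi (k + 1)\<rfloor> = 0"
      using * assms by (auto simp: floor_eq_iff)
    then show "\<not> coord (bin_digits h) k"
      using assms by (simp add: coord_bin_digits)
  qed
qed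

lemma div2_odd_iff: "x div 2 = m \<and> odd x = b \<longleftrightarrow> x = 2 * m + of_bool b" for x m :: int
  by (cases b) (simp_all, presburger+)

lemma bin_digits_cyl:
  "\<exists>m\<ge>0. \<forall>h\<ge>0. bin_digits h \<in> cyl n a \<longleftrightarrow> \<lfloor>h * 2 powi n\<rfloor> = m"
proof -
  obtain L where L: "\<forall>k<L. \<not> coord a k"
    using coord_bounded_below by blast
  have base: "\<exists>m\<ge>0. \<forall>h\<ge>0. bin_digits h \<in> cyl n a \<longleftrightarrow> \<lfloor>h * 2 powi n\<rfloor> = m" if "n \<le> L" for n
  proof (intro exI[of _ 0] conjI allI impI)
    fix h :: real assume "h \<ge> 0"
    have "bin_digits h \<in> cyl n a \<longleftrightarrow> (\<forall>k<n. \<not> coord (bin_digits h) k)"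
      using L that by (simp add: cyl_def)
    then show "bin_digits h \<in> cyl n a \<longleftrightarrow> \<lfloor>h * 2 powi n\<rfloor> = 0"
      using bin_digits_low[OF \<open>h \<ge> 0\<close>] by simp
  qed simp
  show ?thesis
  proof (cases "n \<le> L")
    case False
    then have "L \<le> n"
      by simp
    then show ?thesis
    proof (induction n rule: int_ge_induct)
      case (step i)
      then obtain m where m: "m \<ge> 0"
        "\<And>h. h \<ge> 0 \<Longrightarrow> bin_digits h \<in> cyl i a \<longleftrightarrow> \<lfloor>h * 2 powi i\<rfloor> = m"
        by blast
      have "bin_digits h \<in> cyl (i + 1) a \<longleftrightarrow> \<lfloor>h * 2 powi (i + 1)\<rfloor> = 2 * m + of_bool (coord a i)"
        if h: "h \<ge> 0" for h
      proof -
        have "bin_digits h \<in> cyl (i + 1) a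
            \<longleftrightarrow> bin_digits h \<in> cyl i a \<and> coord (bin_digits h) i = coord a i"
          by (rule cyl_add1_iff)
        also have "\<dots> \<longleftrightarrow> \<lfloor>h * 2 powi i\<rfloor> = m \<and> odd \<lfloor>h * 2 powi (i + 1)\<rfloor> = coord a i"
          using m(2) h by (simp add: coord_bin_digits)
        also have "\<lfloor>h * 2 powi i\<rfloor> = \<lfloor>h * 2 powi (i + 1)\<rfloor> div 2"
          using floor_divide_real_eq_div[of 2 "h * 2 powi (i + 1)"]
          by (simp add: power_int_add)
        finally show ?thesis
          by (simp only: div2_odd_iff)
      qed
      then show ?case
        using m(1) by (intro exI[of _ "2 * m + of_bool (coord a i)"]) auto
    qed (rule base, simp)
  qed (rule base)
qed

lemma floor_slice:
  assumes "m \<ge> 0"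
  shows "{h. 0 \<le> h \<and> \<lfloor>h * 2 powi n\<rfloor> = m} = {of_int m * 2 powi (- n) ..< (of_int m + 1) * (2::real) powi (- n)}"
proof -
  have iff: "\<lfloor>h * 2 powi n\<rfloor> = m \<longleftrightarrow>
      of_int m * 2 powi (- n) \<le> h \<and> h < (of_int m + 1) * 2 powi (- n)" for h :: real
  proof -
    have "of_int m \<le> h * 2 powi n \<longleftrightarrow> of_int m * 2 powi (- n) \<le> h"
      "h * 2 powi n < of_int m + 1 \<longleftrightarrow> h < (of_int m + 1) * 2 powi (- n)"
      unfolding power_int_minus divide_inverse[symmetric]
      by (simp_all only: pos_divide_le_eq pos_less_divide_eq zero_less_power_int zero_less_numeral)
    then show ?thesis
      by (simp only: floor_eq_iff)
  qed
  have "h \<ge> 0" if "of_int m * 2 powi (- n) \<le> h" for h :: real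
    using that assms by (smt (verit) mult_nonneg_nonneg of_int_nonneg zero_le_power_int)
  then show ?thesis
    unfolding iff by auto
qed

lemma haar_exists: "\<exists>\<mu>. normalized_haar \<mu>"
proof -
  define M where "M = restrict_space (lborel :: real measure) {0..}"
  define \<mu> where "\<mu> = distr M borel bin_digits"
  have sp: "space M = {0..}"
    by (simp add: M_def space_restrict_space)
  have slice: "\<exists>m\<ge>0. bin_digits -` cyl n a \<inter> space M = {of_int m * 2 powi (- n) ..< (of_int m + 1) * 2 powi (- n)}"
    for n a
  proof -
    obtain m where m: "m \<ge> 0" "\<And>h. h \<ge> 0 \<Longrightarrow> bin_digits h \<in> cyl n a \<longleftrightarrow> \<lfloor>h * 2 powi n\<rfloor> = m"
      using bin_digits_cyl[of n a] by blast
    have "bin_digits -` cyl n a \<inter> space M = {h. 0 \<le> h \<and> \<lfloor>h * 2 powi n\<rfloor> = m}"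
      using m(2) by (auto simp: sp)
    then show ?thesis
      using m(1) floor_slice by blast
  qed
  have meas [measurable]: "bin_digits \<in> M \<rightarrow>\<^sub>M borel"
    unfolding borel_eq_cyls
  proof (rule measurable_measure_of)
    fix A assume "A \<in> cyls"
    then consider "A = {}" | n a where "A = cyl n a"
      by (auto simp: cyls_def)
    then show "bin_digits -` A \<inter> space M \<in> sets M"
    proof cases
      case 2
      then obtain m where m: "m \<ge> (0::int)"
        "bin_digits -` A \<inter> space M = {of_int m * 2 powi (- n) ..< (of_int m + 1) * 2 powi (- n)}"
        using slice by blast
      have "bin_digits -` A \<inter> space M \<subseteq> {0..}"
        by (auto simp: sp)
      then show ?thesis
        unfolding M_def by (subst sets_restrict_space_iff) (use m M_def in auto)
    qed simp
  qed auto
  have cyl: "emeasure \<mu> (cyl n a) = ennreal (2 powi (- n))" for n a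
  proof -
    obtain m where m: "m \<ge> (0::int)"
      "bin_digits -` cyl n a \<inter> space M = {of_int m * 2 powi (- n) ..< (of_int m + 1) * 2 powi (- n)}"
      using slice by blast
    have "emeasure \<mu> (cyl n a) = emeasure M (bin_digits -` cyl n a \<inter> space M)"
      unfolding \<mu>_def by (rule emeasure_distr) (auto simp: meas open_cyl)
    also have "\<dots> = emeasure lborel (bin_digits -` cyl n a \<inter> space M)"
      unfolding M_def by (rule emeasure_restrict_space) (auto simp: space_restrict_space)
    also have "\<dots> = ennreal (2 powi (- n))"
      unfolding m(2) by (subst emeasure_lborel_Ico) (auto simp: algebra_simps)
    finally show ?thesis .
  qed
  have [simp, measurable_cong]: "sets \<mu> = sets borel" and [simp]: "space \<mu> = UNIV"
    by (simp_all add: \<mu>_def)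
  have "distr \<mu> borel (\<lambda>x. a + x) = \<mu>" for a
  proof (rule dyadic_measure_eqI)
    show "emeasure (distr \<mu> borel (\<lambda>x. a + x)) (cyl n b) = ennreal (2 powi (- n))" for n b
      by (subst emeasure_distr) (auto simp: translate_vimage_cyl open_cyl cyl)
  qed (auto simp: cyl)
  then have "normalized_haar \<mu>"
    by (simp add: normalized_haar_def I_ball_eq_cyl cyl)
  then show ?thesis ..
qed

lemma normalized_haar_unique_existence: "\<exists>!\<mu>. normalized_haar \<mu>"
proof -
  have "M = N" if "normalized_haar M" "normalized_haar N" for M N
    using that normalized_haar_cyl
    by (intro dyadic_measure_eqI) (auto simp: normalized_haar_def)
  then show ?thesis
    using haar_exists by blast
qed

lemma normalized_haar_haar: "normalized_haar haar"
  unfolding haar_def by (rule theI') (rule normalized_haar_unique_existence)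

section \<open>Shifts, periodic functions, Walsh functions and the Gibbs derivative\<close>

definition lam :: "dyadic \<Rightarrow> real" where
  "lam x = (\<Sum>\<^sub>\<infinity>j\<in>UNIV. of_bool (coord x j) * 2 powi (- j - 1))"

definition lam_inv :: "real \<Rightarrow> dyadic" where
  "lam_inv = inv_into {x. \<not> (\<exists>m. \<forall>k\<ge>m. coord x k)} lam"

definition shift :: "real \<Rightarrow> (dyadic \<Rightarrow> complex) \<Rightarrow> dyadic \<Rightarrow> complex" where
  "shift h f x = f (x + lam_inv h)"

definition periodic1 :: "(dyadic \<Rightarrow> complex) \<Rightarrow> bool" where
  "periodic1 f \<longleftrightarrow> (\<forall>x. \<forall>n::nat. f (x + lam_inv (real n)) = f x)"

text \<open>The exponent \<open>\<Sum>k. t\<^sub>k x\<^bsub>-k-1\<^esub>\<close> counts the indices at which both digits are 1;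
  there are finitely many, as \<open>t\<close> has only finitely many nonzero digits.\<close>

definition walsh :: "nat \<Rightarrow> dyadic \<Rightarrow> complex" where
  "walsh n x = (- 1) ^ card {k. coord (lam_inv (real n)) k \<and> coord x (- k - 1)}"

text \<open>\<^const>\<open>lim\<close> is unspecified where the limit does not exist. For 1-periodic locally constant
  \<open>f\<close> the partial sums are eventually constant in \<open>n\<close>.\<close>

definition gibbs :: "(dyadic \<Rightarrow> complex) \<Rightarrow> dyadic \<Rightarrow> complex" where
  "gibbs f x = lim (\<lambda>n. \<Sum>j\<in>{- int n..int n}. 2 powi (j - 1) * (f x - shift (2 powi (- j - 1)) f x))"

section \<open>Test functions and distributions\<close>

definition test_functions :: "(dyadic \<Rightarrow> complex) set" where
  "test_functions = {\<phi>. periodic1 \<phi> \<and> (\<forall>x. \<exists>r>0. \<phi> constant_on ball x r)}"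

definition test_null :: "(nat \<Rightarrow> dyadic \<Rightarrow> complex) \<Rightarrow> bool" where
  "test_null \<phi> \<longleftrightarrow> (\<forall>i. \<phi> i \<in> test_functions) \<and>
     (\<exists>r>0. \<forall>i x. \<phi> i constant_on ball x r) \<and>
     uniform_limit I_unit \<phi> (\<lambda>_. 0) sequentially"

type_synonym functional = "(dyadic \<Rightarrow> complex) \<Rightarrow> complex"

text \<open>Functionals on the space of test functions are made extensional, so that
  equality of distributions is equality of HOL functions.\<close>

definition distributions :: "functional set" where
  "distributions = {F \<in> extensional test_functions.
     (\<forall>\<phi>\<in>test_functions. \<forall>\<psi>\<in>test_functions. F (\<lambda>x. \<phi> x + \<psi> x) = F \<phi> + F \<psi>) \<and>
     (\<forall>c. \<forall>\<phi>\<in>test_functions. F (\<lambda>x. c * \<phi> x) = c * F \<phi>) \<and>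
     (\<forall>\<phi>. test_null \<phi> \<longrightarrow> (\<lambda>i. F (\<phi> i)) \<longlonglongrightarrow> 0)}"

definition walsh_coeff :: "functional \<Rightarrow> nat \<Rightarrow> complex" where
  "walsh_coeff F n = F (walsh n)"

definition gibbs_dist :: "nat \<Rightarrow> functional \<Rightarrow> functional" where
  "gibbs_dist k F = restrict (\<lambda>\<phi>. F ((gibbs ^^ k) \<phi>)) test_functions"

text \<open>No conjugate on the test function: the pairing is bilinear.\<close>

definition dist_of_fun :: "(dyadic \<Rightarrow> complex) \<Rightarrow> functional" where
  "dist_of_fun u = restrict (\<lambda>\<phi>. set_lebesgue_integral haar I_unit (\<lambda>x. u x * \<phi> x)) test_functions"

definition CP :: "(dyadic \<Rightarrow> complex) set" where
  "CP = {u. periodic1 u \<and> continuous_on UNIV u}"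

definition L2P :: "(dyadic \<Rightarrow> complex) set" where
  "L2P = {u. periodic1 u \<and> set_borel_measurable haar I_unit u \<and>
     set_integrable haar I_unit (\<lambda>x. (norm (u x))\<^sup>2)}"

section \<open>The Cauchy problem\<close>

text \<open>The derivative is taken within \<open>U\<close>, hence one-sided at end points of \<open>U\<close>.\<close>

definition has_weak_derivative ::
  "(real \<Rightarrow> functional) \<Rightarrow> functional \<Rightarrow> real \<Rightarrow> real set \<Rightarrow> bool" where
  "has_weak_derivative f D t U \<longleftrightarrow>
     (\<forall>n. ((\<lambda>s. walsh_coeff (f s) n) has_vector_derivative walsh_coeff D n) (at t within U))"

definition cauchy_solution ::
  "real set \<Rightarrow> functional \<Rightarrow> functional \<Rightarrow> (real \<Rightarrow> functional) \<Rightarrow> bool" where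
  "cauchy_solution U f0 f1 f \<longleftrightarrow> (\<forall>t\<in>U. f t \<in> distributions) \<and>
     (\<exists>f' f''. (\<forall>t\<in>U. f' t \<in> distributions \<and> f'' t \<in> distributions \<and>
          has_weak_derivative f (f' t) t U \<and> has_weak_derivative f' (f'' t) t U \<and>
          f'' t = gibbs_dist 2 (f t)) \<and>
        f 0 = f0 \<and> f' 0 = f1)"

end

theory Submission
  imports Defs
begin

text \<open>
  A 1-periodic locally constant function depends only on finitely many of the digits
  \<open>x\<^sub>0, x\<^sub>1, \<dots>\<close>, hence is a finite Walsh sum. So distributions correspond to arbitrary
  sequences of Walsh coefficients. Since \<open>w\<^sub>n\<close> is an eigenfunction of the Gibbs derivative with
  eigenvalue \<open>n\<close>, the Cauchy problem decouples into the equations \<open>c'' = n\<^sup>2 c\<close>, \<open>c(0) = p\<^sub>n\<close>,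
  \<open>c'(0) = q\<^sub>n\<close>, whose unique solution is \<open>p\<^sub>n cosh(n t) + q\<^sub>n sinh(n t) / n\<close>. It grows at most like
  \<open>(\<bar>p\<^sub>n\<bar> + \<bar>q\<^sub>n\<bar>) exp(n t)\<close> for \<open>n \<ge> 1\<close>, so under the decay hypothesis its coefficients are absolutely
  summable for every \<open>t\<close>, and the Walsh series converges uniformly to a bounded continuous function.
\<close>

section \<open>Binary digits\<close>

text \<open>A geometric series: all positions after \<open>k\<close> together weigh exactly as much
  as position \<open>k\<close>. This borderline equality is what makes binary expansions
  ambiguous.\<close>

lemma powi_tail_has_sum: "((\<lambda>j. 2 powi (- j - 1)) has_sum (2::real) powi (- k - 1)) {k<..}"
proof -
  have eq: "(2::real) powi (- (k + 1 + int i) - 1) = 2 powi (- k - 1) * (1 / 2) ^ Suc i" for i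
  proof -
    have "- (k + 1 + int i) - 1 = (- k - 1) + - int (Suc i)"
      by simp
    then have "(2::real) powi (- (k + 1 + int i) - 1) = 2 powi ((- k - 1) + - int (Suc i))"
      by (simp only:)
    also have "\<dots> = 2 powi (- k - 1) * 2 powi (- int (Suc i))"
      by (rule power_int_add) simp
    also have "(2::real) powi (- int (Suc i)) = (1 / 2) ^ Suc i"
      by (simp only: power_int_minus power_int_of_nat power_one_over inverse_eq_divide)
    finally show ?thesis .
  qed
  have "(\<lambda>i. (2::real) powi (- k - 1) * (1 / 2) ^ Suc i) sums (2 powi (- k - 1) * 1)"
    by (rule sums_mult) (rule power_half_series)
  then have "((\<lambda>i. (2::real) powi (- k - 1) * (1 / 2) ^ Suc i) has_sum 2 powi (- k - 1)) UNIV"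
    by (intro sums_nonneg_imp_has_sum) auto
  then have "((\<lambda>j. (2::real) powi (- j - 1)) \<circ> (\<lambda>i. k + 1 + int i) has_sum 2 powi (- k - 1)) UNIV"
    unfolding o_def eq .
  then have "((\<lambda>j. (2::real) powi (- j - 1)) has_sum 2 powi (- k - 1)) (range (\<lambda>i. k + 1 + int i))"
    by (subst has_sum_reindex) (simp_all only: inj_on_def add_left_cancel of_nat_eq_iff, blast)
  moreover have "range (\<lambda>i. k + 1 + int i) = {k<..}"
  proof
    show "{k<..} \<subseteq> range (\<lambda>i. k + 1 + int i)"
    proof
      fix j assume "j \<in> {k<..}"
      then show "j \<in> range (\<lambda>i. k + 1 + int i)"
        by (intro image_eqI[of _ _ "nat (j - k - 1)"]) auto
    qed
  qed auto
  ultimately show ?thesis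
    by (simp only:)
qed

lemma lam_summable: "(\<lambda>j. of_bool (coord x j) * (2::real) powi (- j - 1)) summable_on UNIV"
proof -
  obtain m where m: "\<forall>k<m. \<not> coord x k"
    using coord_bounded_below by blast
  have "(\<lambda>j. of_bool (coord x j) * (2::real) powi (- j - 1)) summable_on {m - 1<..}"
    by (rule summable_on_comparison_test[OF has_sum_imp_summable[OF powi_tail_has_sum]]) auto
  then show ?thesis
    by (rule summable_on_cong_neutral[THEN iffD1, rotated -1]) (use m in auto)
qed

text \<open>The set on which \<open>lam_inv\<close> inverts \<open>lam\<close>. Excluding tails of
  ones removes the ambiguity of binary expansions.\<close>

definition not_eventually_one :: "dyadic set" where
  "not_eventually_one = {x. \<not> (\<exists>m. \<forall>k\<ge>m. coord x k)}"

text \<open>At the first disagreement \<open>x\<close> gains 2^(-k-1). The tail of \<open>y\<close>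
  could compensate only by consisting entirely of ones, and \<open>y\<close> has a zero digit beyond
  \<open>k\<close>.\<close>

lemma lam_less:
  assumes eq: "\<And>j. j < k \<Longrightarrow> coord x j = coord y j" and k: "coord x k" "\<not> coord y k"
    and y: "y \<in> not_eventually_one"
  shows "lam y < lam x"
proof -
  define F where "F z j = of_bool (coord z j) * (2::real) powi (- j - 1)" for z j
  have F: "F z summable_on A" for z A
    using summable_on_subset[OF lam_summable] unfolding F_def by blast
  have split: "lam z = infsum (F z) {..<k} + F z k + infsum (F z) {k<..}" for z
  proof -
    have "(UNIV::int set) = insert k ({..<k} \<union> {k<..})"
      by auto
    moreover have "lam z = infsum (F z) UNIV"
      unfolding lam_def F_def by (rule refl)
    ultimately have "lam z = infsum (F z) (insert k ({..<k} \<union> {k<..}))"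
      by (simp only:)
    also have "\<dots> = F z k + (infsum (F z) {..<k} + infsum (F z) {k<..})"
    proof -
      have "infsum (F z) (insert k ({..<k} \<union> {k<..})) = F z k + infsum (F z) ({..<k} \<union> {k<..})"
        by (rule infsum_insert) (use F in auto)
      also have "infsum (F z) ({..<k} \<union> {k<..}) = infsum (F z) {..<k} + infsum (F z) {k<..}"
        by (rule infsum_Un_disjoint) (use F in auto)
      finally show ?thesis .
    qed
    finally show ?thesis
      by simp
  qed
  have "\<exists>i\<ge>k + 1. \<not> coord y i"
    using y by (simp add: not_eventually_one_def)
  then obtain i where i: "i > k" "\<not> coord y i"
    by (auto simp: add1_zle_eq)
  have "infsum (F y) {k<..} < 2 powi (- k - 1)"
  proof (rule has_sum_strict_mono)
    show "(F y has_sum infsum (F y) {k<..}) {k<..}"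
      using F by (rule has_sum_infsum)
    show "((\<lambda>j. 2 powi (- j - 1)) has_sum (2::real) powi (- k - 1)) {k<..}"
      by (rule powi_tail_has_sum)
    show "F y j \<le> 2 powi (- j - 1)" for j
      by (simp add: F_def)
    show "i \<in> {k<..}" "F y i < 2 powi (- i - 1)"
      using i by (simp_all add: F_def)
  qed
  moreover have "infsum (F x) {k<..} \<ge> 0"
    by (rule infsum_nonneg) (simp add: F_def)
  moreover have "infsum (F x) {..<k} = infsum (F y) {..<k}"
    by (rule infsum_cong) (simp add: F_def eq)
  moreover have "F x k = 2 powi (- k - 1)" "F y k = 0"
    using k by (simp_all add: F_def)
  ultimately show ?thesis
    by (simp add: split)
qed

lemma inj_on_lam: "inj_on lam not_eventually_one"
proof (rule inj_onI, rule ccontr)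
  fix x y
  assume xy: "x \<in> not_eventually_one" "y \<in> not_eventually_one" "lam x = lam y" "x \<noteq> y"
  \<comment> \<open>The first nonzero digit of \<open>x + y\<close> is the first place where
    \<open>x\<close> and \<open>y\<close> disagree, so \<open>lam_less\<close> applies in one order
    or the other.\<close>
  then obtain j where "coord (x + y) j"
    by (auto simp: dyadic_eq_iff)
  note k = first_one_props[OF this]
  have eq: "coord x i = coord y i" if "i < first_one (x + y)" for i
    using k(3)[OF that] by simp
  show False
    using k(1) lam_less[of "first_one (x + y)" x y] lam_less[of "first_one (x + y)" y x] xy eq
    by auto
qed

text \<open>\<open>lam_inv\<close> is an \<open>inv_into\<close>, so its values are found by
  guessing the preimage and invoking injectivity. Having finitely many ones puts \<open>x\<close> in
  the inversion domain and turns the infinite sum into a finite one.\<close>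

lemma lam_inv_eqI:
  assumes "finite {k. coord x k}" "(\<Sum>k | coord x k. 2 powi (- k - 1)) = h"
  shows "lam_inv h = x"
proof -
  have "x \<in> not_eventually_one"
  proof -
    have False if "\<forall>k\<ge>m. coord x k" for m
    proof -
      have "{m..} \<subseteq> {k. coord x k}"
        using that by auto
      then show False
        using assms(1) infinite_Ici finite_subset by blast
    qed
    then show ?thesis
      by (auto simp: not_eventually_one_def)
  qed
  moreover have "lam x = (\<Sum>\<^sub>\<infinity>k\<in>{k. coord x k}. 2 powi (- k - 1))"
    unfolding lam_def by (rule infsum_cong_neutral) auto
  then have "lam x = h"
    using assms by simp
  ultimately show ?thesis
    using inv_into_f_f[OF inj_on_lam] unfolding lam_inv_def not_eventually_one_def by blast
qed

section \<open>Digits of powers of two and of natural numbers\<close>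

definition unit_digit :: "int \<Rightarrow> dyadic" where
  "unit_digit j = Abs_dyadic (\<lambda>k. k = j)"

lemma coord_unit_digit [simp]: "coord (unit_digit j) k \<longleftrightarrow> k = j"
  unfolding unit_digit_def by (subst Abs_dyadic_inverse) (auto intro: exI[of _ j])

lemma lam_inv_powi: "lam_inv (2 powi (- j - 1)) = unit_digit j"
  by (rule lam_inv_eqI) auto

lemma bit_nat_less: "i < n" if "bit (n::nat) i"
proof (rule ccontr)
  assume "\<not> i < n"
  then have "n < 2 ^ i"
    using less_exp[of i] by linarith
  then show False
    using that by (simp add: bit_iff_odd)
qed

lemma finite_bits: "finite {i. bit (n::nat) i}"
  by (rule finite_subset[of _ "{..n}"]) (auto dest: bit_nat_less)

lemma sum_bits: "(\<Sum>i | bit n i. 2 ^ i) = (n::nat)"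
proof -
  \<comment> \<open>Since n < 2^n, cutting off after \<open>n\<close> bits loses nothing.\<close>
  have "n = take_bit n n"
    using less_exp[of n] by (simp add: take_bit_nat_eq_self)
  also have "\<dots> = (\<Sum>i = 0..<n. push_bit i (of_bool (bit n i)))"
    by (rule take_bit_sum)
  also have "\<dots> = (\<Sum>i | bit n i. 2 ^ i)"
    by (rule sum.mono_neutral_cong_right) (auto simp: push_bit_eq_mult dest: bit_nat_less)
  finally show ?thesis ..
qed

text \<open>Position \<open>k\<close> has weight 2^(-k-1), so bit \<open>i\<close> of the integer
  belongs at position -i-1; integers occupy only negative positions.\<close>

definition nat_digits :: "nat \<Rightarrow> dyadic" where
  "nat_digits n = Abs_dyadic (\<lambda>k. k < 0 \<and> bit n (nat (- k - 1)))"

lemma coord_nat_digits [simp]: "coord (nat_digits n) k \<longleftrightarrow> k < 0 \<and> bit n (nat (- k - 1))"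
proof -
  have "\<not> bit n (nat (- k - 1))" if "k < - int n" for k
    using that by (auto dest: bit_nat_less)
  then show ?thesis
    unfolding nat_digits_def by (subst Abs_dyadic_inverse) (auto intro: exI[of _ "- int n"])
qed

lemma lam_inv_nat: "lam_inv (real n) = nat_digits n"
proof (rule lam_inv_eqI)
  have *: "{k. coord (nat_digits n) k} = (\<lambda>i. - int i - 1) ` {i. bit n i}"
  proof (intro equalityI subsetI)
    fix k assume "k \<in> {k. coord (nat_digits n) k}"
    then show "k \<in> (\<lambda>i. - int i - 1) ` {i. bit n i}"
      by (intro image_eqI[of _ _ "nat (- k - 1)"]) auto
  qed auto
  show "finite {k. coord (nat_digits n) k}"
    unfolding * by (simp add: finite_bits)
  have "(\<Sum>k | coord (nat_digits n) k. (2::real) powi (- k - 1)) = (\<Sum>i | bit n i. 2 ^ i)"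
    unfolding * by (subst sum.reindex) (simp_all add: inj_on_def)
  also have "\<dots> = real (\<Sum>i | bit n i. 2 ^ i)"
    by simp
  finally show "(\<Sum>k | coord (nat_digits n) k. (2::real) powi (- k - 1)) = real n"
    by (simp only: sum_bits)
qed

section \<open>Walsh functions and test functions\<close>

text \<open>The Rademacher functions.\<close>

definition digit_sign :: "dyadic \<Rightarrow> nat \<Rightarrow> complex" where
  "digit_sign x i = (if coord x (int i) then - 1 else 1)"

text \<open>Paley's form of the Walsh functions. The index \<open>k\<close> in the definition is
  -i-1 for a bit \<open>i\<close> of \<open>n\<close>, and is paired with digit \<open>i\<close> of
  \<open>x\<close>. Multiplicativity and sign changes are then read off factor by factor.\<close>

lemma walsh_prod: "walsh n x = (\<Prod>i | bit n i. digit_sign x i)"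
proof -
  have "{k. coord (lam_inv (real n)) k \<and> coord x (- k - 1)}
      = (\<lambda>i. - int i - 1) ` {i. bit n i \<and> coord x (int i)}"
    unfolding lam_inv_nat
  proof (intro equalityI subsetI)
    fix k assume "k \<in> {k. coord (nat_digits n) k \<and> coord x (- k - 1)}"
    then show "k \<in> (\<lambda>i. - int i - 1) ` {i. bit n i \<and> coord x (int i)}"
      by (intro image_eqI[of _ _ "nat (- k - 1)"]) auto
  qed auto
  then have "walsh n x = (- 1) ^ card {i. bit n i \<and> coord x (int i)}"
    unfolding walsh_def by (simp add: card_image inj_on_def)
  also have "{i. bit n i \<and> coord x (int i)} = {i \<in> {i. bit n i}. coord x (int i)}"
    by auto
  also have "(- 1) ^ card \<dots> = (\<Prod>i \<in> {i \<in> {i. bit n i}. coord x (int i)}. - 1 :: complex)"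
    by simp
  also have "\<dots> = (\<Prod>i | bit n i. digit_sign x i)"
    unfolding digit_sign_def by (rule prod.inter_filter) (rule finite_bits)
  finally show ?thesis .
qed

lemma walsh_0 [simp]: "walsh 0 x = 1"
  by (simp add: walsh_prod)

lemma walsh_add: "walsh n (x + y) = walsh n x * walsh n y"
  by (simp add: walsh_prod digit_sign_def flip: prod.distrib) (rule prod.cong, auto)

lemma walsh_unit_digit: "walsh n (unit_digit j) = (if j \<ge> 0 \<and> bit n (nat j) then - 1 else 1)"
proof -
  have "walsh n (unit_digit j) = (\<Prod>i | bit n i. if i = nat j then (if j \<ge> 0 then - 1 else 1) else 1)"
    unfolding walsh_prod digit_sign_def by (rule prod.cong) auto
  then show ?thesis
    by (simp add: finite_bits)
qed

lemma walsh_cong: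
  assumes "\<And>i. bit n i \<Longrightarrow> coord x (int i) = coord y (int i)"
  shows "walsh n x = walsh n y"
  unfolding walsh_prod digit_sign_def by (rule prod.cong) (use assms in auto)

lemma walsh_square: "walsh n x * walsh n x = 1"
  by (simp add: walsh_prod digit_sign_def flip: prod.distrib) (rule prod.neutral, auto)

lemma norm_walsh [simp]: "norm (walsh n x) = 1"
  unfolding walsh_prod prod_norm[symmetric] digit_sign_def by (rule prod.neutral) auto

lemma bit_nat_le: "2 ^ i \<le> n" if "bit (n::nat) i"
  by (rule ccontr) (use that in \<open>simp add: bit_iff_odd\<close>)

lemma bit_nat_less_exponent: "i < N" if "bit n i" "n < 2 ^ N" for n :: nat
proof -
  have "(2::nat) ^ i < 2 ^ N"
    using bit_nat_le[OF that(1)] that(2) by linarith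
  then show ?thesis
    by simp
qed

text \<open>Bit \<open>N\<close> is not set in \<open>n\<close>, so adding 2^N causes no carry and
  only appends one Rademacher factor.\<close>

lemma walsh_add_power:
  assumes "n < 2 ^ N"
  shows "walsh (n + 2 ^ N) x = walsh n x * digit_sign x N"
proof -
  have small: "i < N" if "bit n i" for i
    using that assms by (rule bit_nat_less_exponent)
  have "bit (n + 2 ^ N) i \<longleftrightarrow> bit n i \<or> i = N" for i
    by (subst bit_disjunctive_add_iff) (use small in \<open>auto simp: bit_exp_iff\<close>)
  then have "{i. bit (n + 2 ^ N) i} = insert N {i. bit n i}"
    by auto
  moreover have "\<not> bit n N"
    using small by blast
  ultimately show ?thesis
    by (simp add: walsh_prod finite_bits)
qed

text \<open>Digits at negative positions may differ freely, so the condition contains 1-periodicity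
  as well as constancy on all balls of radius 2^(-N).\<close>

definition depends_on_digits :: "nat \<Rightarrow> (dyadic \<Rightarrow> complex) \<Rightarrow> bool" where
  "depends_on_digits N \<phi> \<longleftrightarrow>
     (\<forall>x y. (\<forall>i<N. coord x (int i) = coord y (int i)) \<longrightarrow> \<phi> x = \<phi> y)"

lemma depends_on_digitsD:
  "depends_on_digits N \<phi> \<Longrightarrow> (\<And>i. i < N \<Longrightarrow> coord x (int i) = coord y (int i)) \<Longrightarrow> \<phi> x = \<phi> y"
  by (simp add: depends_on_digits_def)

lemma depends_on_digits_mono: "depends_on_digits M \<phi> \<Longrightarrow> M \<le> N \<Longrightarrow> depends_on_digits N \<phi>"
  unfolding depends_on_digits_def by (meson order_less_le_trans)

lemma depends_on_digits_walsh:
  assumes "n < 2 ^ N"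
  shows "depends_on_digits N (walsh n)"
  unfolding depends_on_digits_def using bit_nat_less_exponent assms by (auto intro: walsh_cong)

text \<open>Induction on the number of digits. Split the function into its even and odd parts under
  flipping digit \<open>N\<close>. The even part, and the odd part times the sign of that digit,
  depend only on the earlier digits; the odd part supplies the Walsh functions whose index has bit
  \<open>N\<close>.\<close>

lemma walsh_expansion_exists:
  assumes "depends_on_digits N \<phi>"
  shows "\<exists>a. \<phi> = (\<lambda>x. \<Sum>n<2 ^ N. a n * walsh n x)"
  using assms
proof (induction N arbitrary: \<phi>)
  case 0
  then have "\<phi> x = \<phi> 0" for x
    by (rule depends_on_digitsD) simp
  then have "\<phi> = (\<lambda>x. \<Sum>n<2 ^ 0. \<phi> 0 * walsh n x)"
    by (intro ext) (simp add: lessThan_Suc)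
  then show ?case
    by (rule exI[of _ "\<lambda>_. \<phi> 0"])
next
  case (Suc N)
  define e where "e = unit_digit (int N)"
  \<comment> \<open>Once the first \<open>N\<close> digits agree, the pairs \<open>x\<close>,
    \<open>x + e\<close> and \<open>y\<close>, \<open>y + e\<close> carry the same two values,
    either in the same order or exchanged together with the sign.\<close>
  have swap: "(\<phi> x = \<phi> y \<and> \<phi> (x + e) = \<phi> (y + e) \<and> digit_sign x N = digit_sign y N)
      \<or> (\<phi> x = \<phi> (y + e) \<and> \<phi> (x + e) = \<phi> y \<and> digit_sign x N = - digit_sign y N)"
    if xy: "\<forall>i<N. coord x (int i) = coord y (int i)" for x y
  proof (cases "coord x (int N) = coord y (int N)")
    case True
    have "\<phi> x = \<phi> y" "\<phi> (x + e) = \<phi> (y + e)"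
      by (rule depends_on_digitsD[OF Suc.prems]; use xy True in \<open>auto simp: less_Suc_eq e_def\<close>)+
    then show ?thesis
      using True by (simp add: digit_sign_def)
  next
    case False
    have "\<phi> x = \<phi> (y + e)" "\<phi> (x + e) = \<phi> y"
      by (rule depends_on_digitsD[OF Suc.prems]; use xy False in \<open>auto simp: less_Suc_eq e_def\<close>)+
    then show ?thesis
      using False by (simp add: digit_sign_def)
  qed
  have "depends_on_digits N (\<lambda>x. (\<phi> x + \<phi> (x + e)) / 2)"
    unfolding depends_on_digits_def
  proof (intro allI impI)
    fix x y assume "\<forall>i<N. coord x (int i) = coord y (int i)"
    from swap[OF this] show "(\<phi> x + \<phi> (x + e)) / 2 = (\<phi> y + \<phi> (y + e)) / 2"
      by (elim disjE conjE) simp_all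
  qed
  from Suc.IH[OF this] obtain a
    where a: "(\<lambda>x. (\<phi> x + \<phi> (x + e)) / 2) = (\<lambda>x. \<Sum>n<2 ^ N. a n * walsh n x)" ..
  have "depends_on_digits N (\<lambda>x. digit_sign x N * (\<phi> x - \<phi> (x + e)) / 2)"
    unfolding depends_on_digits_def
  proof (intro allI impI)
    fix x y assume "\<forall>i<N. coord x (int i) = coord y (int i)"
    from swap[OF this]
    show "digit_sign x N * (\<phi> x - \<phi> (x + e)) / 2 = digit_sign y N * (\<phi> y - \<phi> (y + e)) / 2"
      by (elim disjE conjE) (simp_all add: algebra_simps)
  qed
  from Suc.IH[OF this] obtain b
    where b: "(\<lambda>x. digit_sign x N * (\<phi> x - \<phi> (x + e)) / 2) = (\<lambda>x. \<Sum>n<2 ^ N. b n * walsh n x)" ..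
  \<comment> \<open>Indices below 2^N come from the even part, those from 2^N on from the odd
    part.\<close>
  define c where "c n = (if n < 2 ^ N then a n else b (n - 2 ^ N))" for n
  have "\<phi> x = (\<Sum>n<2 ^ Suc N. c n * walsh n x)" for x
  proof -
    have "(\<Sum>n<2 ^ Suc N. c n * walsh n x)
        = (\<Sum>n = 0..<2 ^ N. c n * walsh n x) + (\<Sum>n = 2 ^ N..<2 ^ N + 2 ^ N. c n * walsh n x)"
      by (subst sum.atLeastLessThan_concat) (simp_all add: lessThan_atLeast0 mult_2)
    also have "(\<Sum>n = 2 ^ N..<2 ^ N + 2 ^ N. c n * walsh n x)
        = (\<Sum>n = 0..<2 ^ N. c (n + 2 ^ N) * walsh (n + 2 ^ N) x)"
      using sum.shift_bounds_nat_ivl[of "\<lambda>n. c n * walsh n x" 0 "2 ^ N" "2 ^ N"] by simp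
    also have "\<dots> = (\<Sum>n<2 ^ N. b n * walsh n x) * digit_sign x N"
      unfolding sum_distrib_right
      by (rule sum.cong) (auto simp: c_def walsh_add_power lessThan_atLeast0)
    also have "(\<Sum>n = 0..<2 ^ N. c n * walsh n x) = (\<Sum>n<2 ^ N. a n * walsh n x)"
      by (rule sum.cong) (auto simp: c_def lessThan_atLeast0)
    finally have "(\<Sum>n<2 ^ Suc N. c n * walsh n x)
        = (\<phi> x + \<phi> (x + e)) / 2 + (digit_sign x N * (\<phi> x - \<phi> (x + e)) / 2) * digit_sign x N"
      by (simp only: fun_cong[OF a] fun_cong[OF b])
    also have "\<dots> = \<phi> x"
      by (simp add: digit_sign_def field_simps)
    finally show ?thesis ..
  qed
  then show ?case
    by blast
qed

section \<open>Periodicity and local constancy as dependence on finitely many digits\<close>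

lemma nat_digits_surj:
  assumes "\<And>k. k \<ge> 0 \<Longrightarrow> \<not> coord z k"
  shows "\<exists>n. z = nat_digits n"
proof -
  obtain m where m: "\<forall>k<m. \<not> coord z k"
    using coord_bounded_below by blast
  \<comment> \<open>Reads the digits at positions -1, -2, ..., \<open>m\<close> as bits 0, 1, ... of
    an integer.\<close>
  define n :: nat where
    "n = horner_sum of_bool 2 (map (\<lambda>i. coord z (- int i - 1)) [0..<nat (- m)])"
  have "bit n i \<longleftrightarrow> coord z (- int i - 1)" for i
  proof -
    have "i < nat (- m)" if "coord z (- int i - 1)"
    proof -
      have "\<not> - int i - 1 < m"
        using m that by blast
      then show ?thesis
        by linarith
    qed
    then show ?thesis
      by (auto simp: n_def bit_horner_sum_bit_iff)
  qed
  then have "coord z k = coord (nat_digits n) k" for k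
    using assms[of k] by auto
  then show ?thesis
    by (auto simp: dyadic_eq_iff)
qed

text \<open>If the nonnegative digits agree, \<open>x + y\<close> has only negative digits and is
  therefore an integer shift, which carries \<open>x\<close> to \<open>y\<close>.\<close>

lemma periodic1_cong:
  assumes "periodic1 f" and "\<And>k. k \<ge> 0 \<Longrightarrow> coord x k = coord y k"
  shows "f x = f y"
proof -
  obtain n where "x + y = nat_digits n"
    using nat_digits_surj[of "x + y"] assms(2) by auto
  then have "f (x + (x + y)) = f x"
    using assms(1) unfolding periodic1_def lam_inv_nat by metis
  moreover have "x + (x + y) = y"
    by (auto simp: dyadic_eq_iff)
  ultimately show ?thesis
    by simp
qed

text \<open>A \<open>bad\<close> cylinder contains a bad one of half the size, and nested bad cylinders shrink to a
  point at which \<open>\<phi>\<close> is not locally constant.\<close>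

lemma locally_constant_uniform:
  assumes lc: "\<And>x. \<exists>r>0. \<phi> constant_on ball x r"
  shows "\<exists>N. \<forall>x\<in>I_unit. \<forall>y\<in>I_unit. (\<forall>i<N. coord x (int i) = coord y (int i)) \<longrightarrow> \<phi> x = \<phi> y"
proof (rule ccontr)
  define bad where "bad n a \<longleftrightarrow> (\<nexists>N. \<forall>x\<in>cyl (int n) a. \<forall>y\<in>cyl (int n) a.
      (\<forall>i<N. coord x (int i) = coord y (int i)) \<longrightarrow> \<phi> x = \<phi> y)" for n a
  assume "\<not> ?thesis"
  then have bad0: "bad 0 0"
    by (simp add: bad_def I_ball_eq_cyl)
  have bad_Suc: "\<exists>b. bad (Suc n) b \<and> b \<in> cyl (int n) a" if bad: "bad n a" for n a
  proof (rule ccontr)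
    let ?b = "a + unit_digit (int n)"
    assume "\<nexists>b. bad (Suc n) b \<and> b \<in> cyl (int n) a"
    then have "\<not> bad (Suc n) a" "\<not> bad (Suc n) ?b"
      by (auto simp: cyl_def)
    then obtain N1 N2 where N:
      "\<And>x y. x \<in> cyl (int (Suc n)) a \<Longrightarrow> y \<in> cyl (int (Suc n)) a \<Longrightarrow>
        (\<forall>i<N1. coord x (int i) = coord y (int i)) \<Longrightarrow> \<phi> x = \<phi> y"
      "\<And>x y. x \<in> cyl (int (Suc n)) ?b \<Longrightarrow> y \<in> cyl (int (Suc n)) ?b \<Longrightarrow>
        (\<forall>i<N2. coord x (int i) = coord y (int i)) \<Longrightarrow> \<phi> x = \<phi> y"
      unfolding bad_def by blast
    \<comment> \<open>If both halves of the cylinder were good, one bound would serve the whole: it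
      covers \<open>N1\<close> and \<open>N2\<close>, and it includes digit \<open>n\<close>, which
      forces \<open>x\<close> and \<open>y\<close> into the same half.\<close>
    have "\<phi> x = \<phi> y" if xy: "x \<in> cyl (int n) a" "y \<in> cyl (int n) a"
      "\<forall>i<N1 + N2 + Suc n. coord x (int i) = coord y (int i)" for x y
    proof -
      have Suc: "int (Suc n) = int n + 1"
        by simp
      have n: "coord x (int n) = coord y (int n)"
        using xy(3) by simp
      have le: "\<forall>i<N1. coord x (int i) = coord y (int i)" "\<forall>i<N2. coord x (int i) = coord y (int i)"
        using xy(3) by auto
      have b: "cyl (int n) ?b = cyl (int n) a"
        by (auto simp: cyl_def)
      show ?thesis
      proof (cases "coord x (int n) = coord a (int n)")
        case True
        then show ?thesis
          using xy n le by (intro N(1)) (auto simp: Suc cyl_add1_iff simp del: of_nat_Suc)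
      next
        case False
        then show ?thesis
          using xy n le by (intro N(2)) (auto simp: Suc cyl_add1_iff b simp del: of_nat_Suc)
      qed
    qed
    then show False
      using bad unfolding bad_def by blast
  qed
  \<comment> \<open>The extra invariant \<open>a n \<in> cyl 0 0\<close> keeps the negative digits
    zero, so that the limit point, built from nonnegative digits only, lies in every
    cylinder.\<close>
  have "\<exists>a. \<forall>n. (bad n (a n) \<and> a n \<in> cyl 0 0) \<and> a (Suc n) \<in> cyl (int n) (a n)"
  proof (rule dependent_nat_choice)
    show "\<exists>a. bad 0 a \<and> a \<in> cyl 0 0"
      using bad0 by (auto simp: cyl_def)
    fix a n assume "bad n a \<and> a \<in> cyl 0 0"
    then show "\<exists>b. (bad (Suc n) b \<and> b \<in> cyl 0 0) \<and> b \<in> cyl (int n) a"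
      using bad_Suc[of n a] by (force simp: cyl_def)
  qed
  then obtain a where a: "\<And>n. bad n (a n)" "\<And>n. a n \<in> cyl 0 0" "\<And>n. a (Suc n) \<in> cyl (int n) (a n)"
    by blast
  have nested: "a (n + m) \<in> cyl (int n) (a n)" for n m
  proof (induction m)
    case (Suc m)
    then show ?case
      using a(3)[of "n + m"] by (simp add: cyl_def)
  qed (simp add: cyl_def)
  \<comment> \<open>The limit of the centres: from index \<open>k + 1\<close> on, digit
    \<open>k\<close> of the centres no longer changes.\<close>
  define x where "x = Abs_dyadic (\<lambda>k. k \<ge> 0 \<and> coord (a (Suc (nat k))) k)"
  have x: "coord x k \<longleftrightarrow> k \<ge> 0 \<and> coord (a (Suc (nat k))) k" for k
    unfolding x_def by (subst Abs_dyadic_inverse) (auto intro: exI[of _ 0])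
  have "x \<in> cyl (int n) (a n)" for n
  proof -
    have "coord x k = coord (a n) k" if k: "k < int n" for k
    proof (cases "k \<ge> 0")
      case True
      then have "a n \<in> cyl (int (Suc (nat k))) (a (Suc (nat k)))"
        using nested[of "Suc (nat k)" "n - Suc (nat k)"] k by simp
      then show ?thesis
        using True by (simp add: x cyl_def)
    next
      case False
      then show ?thesis
        using a(2)[of n] by (simp add: x cyl_def)
    qed
    then show ?thesis
      by (simp add: cyl_def)
  qed
  then have cyl_x: "cyl (int n) (a n) = cyl (int n) x" for n
    by (rule cyl_cong)
  obtain r where r: "r > 0" "\<phi> constant_on ball x r"
    using lc by blast
  obtain n where n: "2 powi (- int n) < r"
    using exists_two_powi_less[OF r(1)] by blast
  have "cyl (int n) (a n) \<subseteq> ball x r"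
    unfolding cyl_x unfolding cyl_eq_ball using n by (intro subset_ball) simp
  moreover obtain c where "\<And>y. y \<in> ball x r \<Longrightarrow> \<phi> y = c"
    using r(2) unfolding constant_on_def by blast
  ultimately have "\<phi> y = c" if "y \<in> cyl (int n) (a n)" for y
    using that by blast
  then have "\<not> bad n (a n)"
    unfolding bad_def by simp
  then show False
    using a(1) by blast
qed

text \<open>Forward, dropping the negative digits moves any point into \<open>I_unit\<close> without
  changing the value, and there local constancy is uniform. Backward, adding an integer alters only
  negative digits.\<close>

lemma test_functions_iff: "\<phi> \<in> test_functions \<longleftrightarrow> (\<exists>N. depends_on_digits N \<phi>)"
proof
  assume \<phi>: "\<phi> \<in> test_functions"
  then have per: "periodic1 \<phi>" and "\<And>x. \<exists>r>0. \<phi> constant_on ball x r"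
    by (auto simp: test_functions_def)
  from locally_constant_uniform[OF this(2)] obtain N
    where N: "\<And>x y. x \<in> I_unit \<Longrightarrow> y \<in> I_unit \<Longrightarrow> (\<forall>i<N. coord x (int i) = coord y (int i)) \<Longrightarrow> \<phi> x = \<phi> y"
    by blast
  define frac where "frac x = Abs_dyadic (\<lambda>k. k \<ge> 0 \<and> coord x k)" for x
  have frac: "coord (frac x) k \<longleftrightarrow> k \<ge> 0 \<and> coord x k" for x k
    unfolding frac_def by (subst Abs_dyadic_inverse) (auto intro: exI[of _ 0])
  have \<phi>_frac: "\<phi> x = \<phi> (frac x)" for x
    by (rule periodic1_cong[OF per]) (simp add: frac)
  have frac_unit: "frac x \<in> I_unit" for x
    by (simp add: I_ball_eq_cyl cyl_def frac)
  have "depends_on_digits N \<phi>"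
    unfolding depends_on_digits_def
  proof (intro allI impI)
    fix x y assume "\<forall>i<N. coord x (int i) = coord y (int i)"
    then have "\<phi> (frac x) = \<phi> (frac y)"
      by (intro N frac_unit) (simp add: frac)
    then show "\<phi> x = \<phi> y"
      using \<phi>_frac[of x] \<phi>_frac[of y] by simp
  qed
  then show "\<exists>N. depends_on_digits N \<phi>" ..
next
  assume "\<exists>N. depends_on_digits N \<phi>"
  then obtain N where N: "depends_on_digits N \<phi>" ..
  have "\<phi> (x + nat_digits n) = \<phi> x" for x n
    by (rule depends_on_digitsD[OF N]) simp
  moreover have "\<phi> constant_on ball x (2 powi (- int N))" for x
    unfolding constant_on_def
  proof (intro exI ballI)
    fix y assume "y \<in> ball x (2 powi (- int N))"
    then show "\<phi> y = \<phi> x"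
      unfolding cyl_eq_ball[symmetric]
      by (intro depends_on_digitsD[OF N]) (simp add: cyl_def)
  qed
  then have "\<exists>r>0. \<phi> constant_on ball x r" for x
    by (intro exI[of _ "2 powi (- int N)"]) simp
  ultimately show "\<phi> \<in> test_functions"
    by (simp add: test_functions_def periodic1_def lam_inv_nat)
qed

section \<open>Walsh functions as eigenfunctions of the Gibbs derivative\<close>

lemma gibbs_sum_tendsto:
  "(\<lambda>n. \<Sum>j\<in>{- int n..int n}. 2 powi (j - 1) * (walsh m x - shift (2 powi (- j - 1)) (walsh m) x))
     \<longlonglongrightarrow> of_nat m * walsh m x"
proof (rule tendsto_eventually)
  have "(\<Sum>j\<in>{- int n..int n}. 2 powi (j - 1) * (walsh m x - shift (2 powi (- j - 1)) (walsh m) x))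
      = of_nat m * walsh m x" if "n \<ge> m" for n
  proof -
    have powi: "(2::complex) powi (int i - 1) * (2 * y) = 2 ^ i * y" for i y
      by (simp add: power_int_diff)
    \<comment> \<open>The shift of index \<open>j\<close> flips digit \<open>j\<close> of
      \<open>x\<close>, which changes the sign of \<open>walsh m\<close> exactly when bit
      \<open>j\<close> of \<open>m\<close> is set. Only these terms survive, each contributing 2^j,
      and all such \<open>j\<close> lie below \<open>m\<close>, hence within the range of
      summation.\<close>
    have "(\<Sum>j\<in>{- int n..int n}. 2 powi (j - 1) * (walsh m x - shift (2 powi (- j - 1)) (walsh m) x))
        = (\<Sum>j\<in>int ` {i. bit m i}. 2 powi (j - 1) * (2 * walsh m x))"
    proof (rule sum.mono_neutral_cong_right)
      show "int ` {i. bit m i} \<subseteq> {- int n..int n}"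
        using that by (auto dest!: bit_nat_less)
      show "\<forall>j\<in>{- int n..int n} - int ` {i. bit m i}.
          2 powi (j - 1) * (walsh m x - shift (2 powi (- j - 1)) (walsh m) x) = 0"
      proof
        fix j assume "j \<in> {- int n..int n} - int ` {i. bit m i}"
        then have *: "\<not> (j \<ge> 0 \<and> bit m (nat j))"
          by (auto simp: image_iff)
        then show "2 powi (j - 1) * (walsh m x - shift (2 powi (- j - 1)) (walsh m) x) = 0"
          unfolding shift_def lam_inv_powi walsh_add walsh_unit_digit if_not_P[OF *] by simp
      qed
      fix j assume "j \<in> int ` {i. bit m i}"
      then show "2 powi (j - 1) * (walsh m x - shift (2 powi (- j - 1)) (walsh m) x)
          = 2 powi (j - 1) * (2 * walsh m x)"
        unfolding shift_def lam_inv_powi walsh_add walsh_unit_digit by auto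
    qed simp
    also have "\<dots> = (\<Sum>i | bit m i. 2 ^ i * walsh m x)"
      by (simp only: sum.reindex[OF inj_on_of_nat] o_def powi)
    also have "\<dots> = of_nat (\<Sum>i | bit m i. 2 ^ i) * walsh m x"
      by (simp add: sum_distrib_right)
    finally show ?thesis
      by (simp only: sum_bits)
  qed
  then show "\<forall>\<^sub>F n in sequentially.
      (\<Sum>j\<in>{- int n..int n}. 2 powi (j - 1) * (walsh m x - shift (2 powi (- j - 1)) (walsh m) x))
        = of_nat m * walsh m x"
    unfolding eventually_sequentially by blast
qed

text \<open>Linearity is established on the partial sums, where convergence is known, because
  \<open>lim\<close> itself is unspecified on divergent sequences.\<close>

lemma gibbs_walsh_sum:
  "gibbs (\<lambda>x. \<Sum>k\<in>A. a k * walsh k x) = (\<lambda>x. \<Sum>k\<in>A. of_nat k * a k * walsh k x)"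
proof
  fix x
  have "(\<lambda>n. \<Sum>k\<in>A. a k * (\<Sum>j\<in>{- int n..int n}.
        2 powi (j - 1) * (walsh k x - shift (2 powi (- j - 1)) (walsh k) x)))
      \<longlonglongrightarrow> (\<Sum>k\<in>A. a k * (of_nat k * walsh k x))"
    by (intro tendsto_intros gibbs_sum_tendsto)
  moreover have "(\<Sum>k\<in>A. a k * (\<Sum>j\<in>{- int n..int n}.
        2 powi (j - 1) * (walsh k x - shift (2 powi (- j - 1)) (walsh k) x)))
      = (\<Sum>j\<in>{- int n..int n}. 2 powi (j - 1) * ((\<Sum>k\<in>A. a k * walsh k x)
            - shift (2 powi (- j - 1)) (\<lambda>x. \<Sum>k\<in>A. a k * walsh k x) x))" for n
    unfolding shift_def sum_distrib_left sum_subtractf[symmetric]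
    by (subst sum.swap) (simp only: algebra_simps)
  ultimately have "gibbs (\<lambda>x. \<Sum>k\<in>A. a k * walsh k x) x = (\<Sum>k\<in>A. a k * (of_nat k * walsh k x))"
    unfolding gibbs_def by (intro limI) (simp only:)
  then show "gibbs (\<lambda>x. \<Sum>k\<in>A. a k * walsh k x) x = (\<Sum>k\<in>A. of_nat k * a k * walsh k x)"
    by (simp only: ac_simps)
qed

lemma gibbs_gibbs_walsh_sum:
  "(gibbs ^^ 2) (\<lambda>x. \<Sum>k\<in>A. a k * walsh k x) = (\<lambda>x. \<Sum>k\<in>A. (of_nat k)\<^sup>2 * a k * walsh k x)"
proof -
  have "(gibbs ^^ 2) (\<lambda>x. \<Sum>k\<in>A. a k * walsh k x) = gibbs (gibbs (\<lambda>x. \<Sum>k\<in>A. a k * walsh k x))"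
    by (simp add: numeral_2_eq_2)
  also have "\<dots> = (\<lambda>x. \<Sum>k\<in>A. of_nat k * (of_nat k * a k) * walsh k x)"
    by (simp only: gibbs_walsh_sum)
  finally show ?thesis
    by (simp only: power2_eq_square mult.assoc)
qed

section \<open>Orthonormality\<close>

text \<open>As a measure of total mass 1 in its own right, it makes every bounded continuous
  function integrable.\<close>

abbreviation unit_haar :: "dyadic measure" where
  "unit_haar \<equiv> restrict_space haar I_unit"

lemma sets_haar [measurable_cong, simp]: "sets haar = sets borel"
  and space_haar [simp]: "space haar = UNIV"
  and haar_translate: "distr haar borel (\<lambda>x. a + x) = haar"
  and emeasure_I_unit: "emeasure haar I_unit = 1"
proof -
  show *: "sets haar = sets borel"
    using normalized_haar_haar by (simp add: normalized_haar_def)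
  show "space haar = UNIV"
    using sets_eq_imp_space_eq[OF *] by simp
  show "distr haar borel (\<lambda>x. a + x) = haar" "emeasure haar I_unit = 1"
    using normalized_haar_haar by (auto simp: normalized_haar_def)
qed

lemma borel_I_unit [measurable, simp]: "I_unit \<in> sets borel"
  by (simp add: I_ball_eq_cyl open_cyl)

lemma set_integral_unit:
  "set_lebesgue_integral haar I_unit f = integral\<^sup>L unit_haar (f :: dyadic \<Rightarrow> complex)"
  unfolding set_lebesgue_integral_def by (rule integral_restrict_space[symmetric]) simp

lemma space_unit_haar [simp]: "space unit_haar = I_unit"
  by (simp add: space_restrict_space)

lemma emeasure_unit_haar: "emeasure unit_haar I_unit = 1"
  by (simp add: emeasure_restrict_space emeasure_I_unit)

lemma finite_measure_unit_haar: "finite_measure unit_haar"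
  by (rule finite_measureI) (simp add: emeasure_unit_haar)

lemma measure_unit_haar: "measure unit_haar I_unit = 1"
  by (simp add: measure_def emeasure_unit_haar)

lemma integrable_unit:
  fixes f :: "dyadic \<Rightarrow> complex"
  assumes "continuous_on UNIV f" "\<And>x. norm (f x) \<le> B"
  shows "integrable unit_haar f"
proof (rule finite_measure.integrable_const_bound[OF finite_measure_unit_haar])
  have "f \<in> borel_measurable haar"
    using borel_measurable_continuous_onI[OF assms(1)] by simp
  then show "f \<in> borel_measurable unit_haar"
    by (rule measurable_restrict_space1)
qed (rule AE_I2, rule assms(2))

text \<open>\<open>I_unit\<close> is a subgroup, so translation by one of its elements preserves
  both it and Haar measure.\<close>

lemma integral_unit_translate:
  fixes f :: "dyadic \<Rightarrow> complex"
  assumes a: "a \<in> I_unit" and f: "continuous_on UNIV f"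
  shows "integral\<^sup>L unit_haar (\<lambda>x. f (a + x)) = integral\<^sup>L unit_haar f"
proof -
  have [measurable]: "f \<in> borel_measurable borel"
    using borel_measurable_continuous_onI[OF f] .
  have "a + x \<in> I_unit \<longleftrightarrow> x \<in> I_unit" for x
    using a by (auto simp: I_ball_eq_cyl cyl_def)
  then have "integral\<^sup>L unit_haar (\<lambda>x. f (a + x)) = (\<integral>x. indicator I_unit (a + x) *\<^sub>R f (a + x) \<partial>haar)"
    by (subst integral_restrict_space) (simp_all add: indicator_def)
  also have "\<dots> = (\<integral>x. indicator I_unit x *\<^sub>R f x \<partial>distr haar borel (\<lambda>x. a + x))"
    by (rule integral_distr[symmetric]) simp_all
  also have "\<dots> = integral\<^sup>L unit_haar f"
    by (simp add: haar_translate integral_restrict_space)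
  finally show ?thesis .
qed

lemma depends_on_digits_continuous:
  assumes "depends_on_digits N \<phi>"
  shows "continuous_on UNIV \<phi>"
  unfolding continuous_on_iff
proof (intro ballI allI impI)
  fix x and e :: real assume "e > 0"
  show "\<exists>d>0. \<forall>y\<in>UNIV. dist y x < d \<longrightarrow> dist (\<phi> y) (\<phi> x) < e"
  proof (intro exI conjI ballI impI)
    fix y assume "dist y x < 2 powi (- int N)"
    then have "y \<in> cyl (int N) x"
      by (simp add: cyl_iff_dist)
    then have "\<phi> y = \<phi> x"
      by (intro depends_on_digitsD[OF assms]) (simp add: cyl_def)
    then show "dist (\<phi> y) (\<phi> x) < e"
      using \<open>e > 0\<close> by simp
  qed simp
qed

lemma walsh_test_function [simp]: "walsh n \<in> test_functions"
  using depends_on_digits_walsh[OF less_exp] test_functions_iff by blast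

lemma continuous_walsh: "continuous_on UNIV (walsh n)"
  using depends_on_digits_walsh[OF less_exp] by (rule depends_on_digits_continuous)

text \<open>For distinct indices choose a bit in which they differ. Translation by the corresponding
  unit digit negates the product but preserves its integral, which must therefore vanish.\<close>

lemma walsh_orthonormal: "integral\<^sup>L unit_haar (\<lambda>x. walsh n x * walsh m x) = (if n = m then 1 else 0)"
proof (cases "n = m")
  case True
  then show ?thesis
    by (simp add: walsh_square measure_unit_haar)
next
  case False
  then obtain j where j: "bit n j \<noteq> bit m j"
    by (auto simp: bit_eq_iff)
  let ?g = "\<lambda>x. walsh n x * walsh m x"
  have neg: "?g (unit_digit (int j) + x) = - ?g x" for x
    using j by (auto simp: walsh_add walsh_unit_digit)
  have "unit_digit (int j) \<in> I_unit"
    by (auto simp: I_ball_eq_cyl cyl_def)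
  then have "integral\<^sup>L unit_haar (\<lambda>x. ?g (unit_digit (int j) + x)) = integral\<^sup>L unit_haar ?g"
    by (intro integral_unit_translate continuous_intros continuous_walsh)
  then have "integral\<^sup>L unit_haar ?g = 0"
    unfolding neg by simp
  then show ?thesis
    using False by simp
qed

section \<open>Walsh coefficients of test functions\<close>

definition walsh_hat :: "(dyadic \<Rightarrow> complex) \<Rightarrow> nat \<Rightarrow> complex" where
  "walsh_hat \<phi> n = integral\<^sup>L unit_haar (\<lambda>x. \<phi> x * walsh n x)"

lemma walsh_hat_sum:
  assumes "finite A"
  shows "walsh_hat (\<lambda>x. \<Sum>k\<in>A. a k * walsh k x) n = (if n \<in> A then a n else 0)"
proof -
  have int: "integrable unit_haar (\<lambda>x. walsh k x * walsh n x)" for k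
    by (rule integrable_unit[where B = 1]) (auto intro!: continuous_intros continuous_walsh simp: norm_mult)
  have "walsh_hat (\<lambda>x. \<Sum>k\<in>A. a k * walsh k x) n
      = integral\<^sup>L unit_haar (\<lambda>x. \<Sum>k\<in>A. a k * (walsh k x * walsh n x))"
    by (simp only: walsh_hat_def sum_distrib_right mult.assoc)
  also have "\<dots> = (\<Sum>k\<in>A. integral\<^sup>L unit_haar (\<lambda>x. a k * (walsh k x * walsh n x)))"
    by (rule Bochner_Integration.integral_sum) (use int in auto)
  also have "\<dots> = (\<Sum>k\<in>A. if k = n then a k else 0)"
    by (rule sum.cong) (simp_all add: walsh_orthonormal)
  finally show ?thesis
    using assms by simp
qed

text \<open>Orthonormality identifies the coefficients of the expansion already shown to exist.
  Their vanishing from 2^N on later turns formal series into finite sums.\<close>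

lemma walsh_expansion:
  fixes n :: nat
  assumes "depends_on_digits N \<phi>"
  shows "\<phi> = (\<lambda>x. \<Sum>n<2 ^ N. walsh_hat \<phi> n * walsh n x)"
    and "n \<ge> 2 ^ N \<Longrightarrow> walsh_hat \<phi> n = 0"
proof -
  obtain a where a: "\<phi> = (\<lambda>x. \<Sum>n<2 ^ N. a n * walsh n x)"
    using walsh_expansion_exists[OF assms] by blast
  have hat: "walsh_hat \<phi> n = (if n < 2 ^ N then a n else 0)" for n
    by (subst a, subst walsh_hat_sum) auto
  have "\<phi> x = (\<Sum>n<2 ^ N. walsh_hat \<phi> n * walsh n x)" for x
    unfolding hat by (subst a) (rule sum.cong, auto)
  then show "\<phi> = (\<lambda>x. \<Sum>n<2 ^ N. walsh_hat \<phi> n * walsh n x)"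
    by (rule ext)
  show "walsh_hat \<phi> n = 0" if "n \<ge> 2 ^ N"
    using that by (simp add: hat)
qed

lemma depends_on_digits_walsh_sum: "depends_on_digits N (\<lambda>x. \<Sum>n<2 ^ N. a n * walsh n x)"
proof -
  have "(\<Sum>n<2 ^ N. a n * walsh n x) = (\<Sum>n<2 ^ N. a n * walsh n y)"
    if "\<forall>i<N. coord x (int i) = coord y (int i)" for x y
  proof (rule sum.cong)
    fix n :: nat assume "n \<in> {..<2 ^ N}"
    then have "walsh n x = walsh n y"
      using that by (intro depends_on_digitsD[OF depends_on_digits_walsh]) auto
    then show "a n * walsh n x = a n * walsh n y"
      by simp
  qed simp
  then show ?thesis
    unfolding depends_on_digits_def by blast
qed

section \<open>Distributions as sequences of Walsh coefficients\<close>

text \<open>The algebraic half of \<open>distributions\<close>. As test functions are finite Walsh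
  sums, linearity alone computes the values on them.\<close>

definition test_linear :: "functional \<Rightarrow> bool" where
  "test_linear F \<longleftrightarrow>
     (\<forall>\<phi>\<in>test_functions. \<forall>\<psi>\<in>test_functions. F (\<lambda>x. \<phi> x + \<psi> x) = F \<phi> + F \<psi>) \<and>
     (\<forall>c. \<forall>\<phi>\<in>test_functions. F (\<lambda>x. c * \<phi> x) = c * F \<phi>)"

lemma test_functions_scale: "\<phi> \<in> test_functions \<Longrightarrow> (\<lambda>x. c * \<phi> x) \<in> test_functions"
  unfolding test_functions_iff depends_on_digits_def by metis

lemma test_functions_add:
  assumes "\<phi> \<in> test_functions" "\<psi> \<in> test_functions"
  shows "(\<lambda>x. \<phi> x + \<psi> x) \<in> test_functions"
proof -
  obtain M N where "depends_on_digits M \<phi>" "depends_on_digits N \<psi>"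
    using assms unfolding test_functions_iff by blast
  then have "depends_on_digits (max M N) \<phi>" "depends_on_digits (max M N) \<psi>"
    by (auto intro: depends_on_digits_mono)
  then show ?thesis
    unfolding test_functions_iff depends_on_digits_def by metis
qed

lemma test_linear_walsh_sum:
  assumes "test_linear F" "finite A"
  shows "F (\<lambda>x. \<Sum>k\<in>A. a k * walsh k x) = (\<Sum>k\<in>A. a k * F (walsh k))"
    and "(\<lambda>x. \<Sum>k\<in>A. a k * walsh k x) \<in> test_functions"
proof -
  have add: "F (\<lambda>x. \<phi> x + \<psi> x) = F \<phi> + F \<psi>"
    if "\<phi> \<in> test_functions" "\<psi> \<in> test_functions" for \<phi> \<psi>
    using assms(1) that by (simp add: test_linear_def)
  have scale: "F (\<lambda>x. c * \<phi> x) = c * F \<phi>" if "\<phi> \<in> test_functions" for c \<phi>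
    using assms(1) that by (simp add: test_linear_def)
  have zero: "F (\<lambda>x. 0) = 0"
    using scale[OF walsh_test_function, of 0 0] by simp
  have zero_test: "(\<lambda>x. 0) \<in> test_functions"
    using test_functions_scale[OF walsh_test_function, of 0 0] by simp
  \<comment> \<open>Both claims go through one induction, because additivity may be applied only to
    sums known to be test functions.\<close>
  have "F (\<lambda>x. \<Sum>k\<in>A. a k * walsh k x) = (\<Sum>k\<in>A. a k * F (walsh k))
      \<and> (\<lambda>x. \<Sum>k\<in>A. a k * walsh k x) \<in> test_functions"
    using assms(2)
  proof (induction A rule: finite_induct)
    case (insert k A)
    then show ?case
      by (simp add: add scale test_functions_add test_functions_scale)
  qed (simp add: zero zero_test)
  then show "F (\<lambda>x. \<Sum>k\<in>A. a k * walsh k x) = (\<Sum>k\<in>A. a k * F (walsh k))"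
    and "(\<lambda>x. \<Sum>k\<in>A. a k * walsh k x) \<in> test_functions"
    by blast+
qed

lemma test_linear_expansion:
  assumes "test_linear F" "depends_on_digits N \<phi>"
  shows "F \<phi> = (\<Sum>n<2 ^ N. walsh_coeff F n * walsh_hat \<phi> n)"
proof -
  have "F \<phi> = F (\<lambda>x. \<Sum>n<2 ^ N. walsh_hat \<phi> n * walsh n x)"
    using walsh_expansion(1)[OF assms(2)] by simp
  also have "\<dots> = (\<Sum>n<2 ^ N. walsh_hat \<phi> n * walsh_coeff F n)"
    by (simp add: test_linear_walsh_sum[OF assms(1)] walsh_coeff_def)
  finally show ?thesis
    by (simp only: mult.commute)
qed

lemma distributions_test_linear: "F \<in> distributions \<Longrightarrow> test_linear F"
  by (simp add: distributions_def test_linear_def)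

lemma distributions_extensional: "F \<in> distributions \<Longrightarrow> F \<in> extensional test_functions"
  by (simp add: distributions_def)

text \<open>On test functions the finite expansion fixes the values; elsewhere extensionality
  does.\<close>

lemma distribution_eqI:
  assumes F: "F \<in> distributions" and G: "G \<in> distributions"
    and eq: "\<And>n. walsh_coeff F n = walsh_coeff G n"
  shows "F = G"
proof (rule extensionalityI)
  show "F \<in> extensional test_functions" "G \<in> extensional test_functions"
    using F G by (auto intro: distributions_extensional)
  fix \<phi> assume "\<phi> \<in> test_functions"
  then obtain N where "depends_on_digits N \<phi>"
    unfolding test_functions_iff by blast
  then show "F \<phi> = G \<phi>"
    using F G by (simp add: test_linear_expansion distributions_test_linear eq)
qed

text \<open>On each test function only finitely many terms are nonzero, so the sum makes sense for
  an arbitrary sequence, however fast it grows.\<close>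

definition walsh_series :: "(nat \<Rightarrow> complex) \<Rightarrow> functional" where
  "walsh_series c = restrict (\<lambda>\<phi>. \<Sum>n. c n * walsh_hat \<phi> n) test_functions"

lemma walsh_series_eq:
  assumes "depends_on_digits N \<phi>"
  shows "walsh_series c \<phi> = (\<Sum>n<2 ^ N. c n * walsh_hat \<phi> n)"
proof -
  have "\<phi> \<in> test_functions"
    using assms test_functions_iff by blast
  then show ?thesis
    unfolding walsh_series_def restrict_apply
    by (simp, subst suminf_finite[of "{..<2 ^ N}"]) (use walsh_expansion(2)[OF assms] in auto)
qed

lemma walsh_hat_walsh: "walsh_hat (walsh m) n = (if n = m then 1 else 0)"
  by (simp add: walsh_hat_def walsh_orthonormal)

lemma walsh_coeff_walsh_series [simp]: "walsh_coeff (walsh_series c) m = c m"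
  unfolding walsh_coeff_def walsh_series_eq[OF depends_on_digits_walsh[OF less_exp]]
  by (simp add: walsh_hat_walsh if_distrib less_exp cong: if_cong)

lemma depends_on_digits_bounded:
  assumes "depends_on_digits N \<phi>"
  shows "\<exists>B. \<forall>x. norm (\<phi> x) \<le> B"
proof (intro exI allI)
  fix x
  have "\<phi> x = (\<Sum>n<2 ^ N. walsh_hat \<phi> n * walsh n x)"
    using walsh_expansion(1)[OF assms] by (rule fun_cong)
  also have "norm \<dots> \<le> (\<Sum>n<2 ^ N. norm (walsh_hat \<phi> n))"
    by (rule sum_norm_le) (simp add: norm_mult)
  finally show "norm (\<phi> x) \<le> (\<Sum>n<2 ^ N. norm (walsh_hat \<phi> n))" .
qed

lemma integrable_test_walsh:
  assumes "\<phi> \<in> test_functions"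
  shows "integrable unit_haar (\<lambda>x. \<phi> x * walsh n x)"
proof -
  obtain N where N: "depends_on_digits N \<phi>"
    using assms test_functions_iff by blast
  obtain B where "\<And>x. norm (\<phi> x) \<le> B"
    using depends_on_digits_bounded[OF N] by blast
  then show ?thesis
    by (intro integrable_unit[where B = B] continuous_intros continuous_walsh
        depends_on_digits_continuous[OF N]) (simp add: norm_mult)
qed

lemma walsh_hat_null:
  assumes "test_null \<phi>"
  shows "(\<lambda>i. walsh_hat (\<phi> i) n) \<longlonglongrightarrow> 0"
proof (rule tendstoI)
  fix e :: real assume e: "e > 0"
  have test: "\<phi> i \<in> test_functions" for i
    using assms by (simp add: test_null_def)
  have "uniform_limit I_unit \<phi> (\<lambda>_. 0) sequentially"
    using assms by (simp add: test_null_def)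
  \<comment> \<open>Half of \<open>e\<close>, since integrating the bound yields only a weak
    inequality.\<close>
  then have "\<forall>\<^sub>F i in sequentially. \<forall>x\<in>I_unit. dist (\<phi> i x) 0 < e / 2"
    using e by (intro uniform_limitD) auto
  then show "\<forall>\<^sub>F i in sequentially. dist (walsh_hat (\<phi> i) n) 0 < e"
  proof eventually_elim
    case (elim i)
    have "norm (walsh_hat (\<phi> i) n) \<le> (\<integral>x. norm (\<phi> i x * walsh n x) \<partial>unit_haar)"
      unfolding walsh_hat_def by (rule integral_norm_bound)
    also have "\<dots> \<le> (\<integral>x. e / 2 \<partial>unit_haar)"
    proof (rule integral_mono)
      show "integrable unit_haar (\<lambda>x. norm (\<phi> i x * walsh n x))"
        by (intro integrable_norm integrable_test_walsh test)
      show "integrable unit_haar (\<lambda>x. e / 2)"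
        by (rule finite_measure.integrable_const[OF finite_measure_unit_haar])
      show "norm (\<phi> i x * walsh n x) \<le> e / 2" if "x \<in> space unit_haar" for x
        using that elim by (auto simp: norm_mult space_restrict_space intro: less_imp_le)
    qed
    also have "\<dots> = e / 2"
      by (simp add: measure_unit_haar)
    finally show ?case
      using e by simp
  qed
qed

text \<open>Continuity holds because the common radius of a null sequence gives one \<open>N\<close>
  for all its members. The values are then sums over the same finite index set, and each coefficient
  tends to zero.\<close>

lemma walsh_series_distribution: "walsh_series c \<in> distributions"
  unfolding distributions_def
proof (intro CollectI conjI ballI allI impI)
  show "walsh_series c \<in> extensional test_functions"
    by (simp add: walsh_series_def)
next
  fix \<phi> \<psi> assume \<phi>\<psi>: "\<phi> \<in> test_functions" "\<psi> \<in> test_functions"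
  then obtain M N where "depends_on_digits M \<phi>" "depends_on_digits N \<psi>"
    unfolding test_functions_iff by blast
  then have dep: "depends_on_digits (max M N) \<phi>" "depends_on_digits (max M N) \<psi>"
    by (auto intro: depends_on_digits_mono)
  then have sum: "depends_on_digits (max M N) (\<lambda>x. \<phi> x + \<psi> x)"
    unfolding depends_on_digits_def by metis
  have "walsh_hat (\<lambda>x. \<phi> x + \<psi> x) n = walsh_hat \<phi> n + walsh_hat \<psi> n" for n
    using \<phi>\<psi> by (simp add: walsh_hat_def distrib_right integrable_test_walsh)
  then show "walsh_series c (\<lambda>x. \<phi> x + \<psi> x) = walsh_series c \<phi> + walsh_series c \<psi>"
    by (simp add: walsh_series_eq[OF dep(1)] walsh_series_eq[OF dep(2)] walsh_series_eq[OF sum]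
        distrib_left sum.distrib)
next
  fix a \<phi> assume "\<phi> \<in> test_functions"
  then obtain N where N: "depends_on_digits N \<phi>"
    unfolding test_functions_iff by blast
  then have sc: "depends_on_digits N (\<lambda>x. a * \<phi> x)"
    unfolding depends_on_digits_def by metis
  have "walsh_hat (\<lambda>x. a * \<phi> x) n = a * walsh_hat \<phi> n" for n
    by (simp add: walsh_hat_def mult.assoc)
  then show "walsh_series c (\<lambda>x. a * \<phi> x) = a * walsh_series c \<phi>"
    by (simp add: walsh_series_eq[OF N] walsh_series_eq[OF sc] sum_distrib_left mult.left_commute)
next
  fix \<phi> assume null: "test_null \<phi>"
  then obtain r where r: "r > 0" "\<And>i x. \<phi> i constant_on ball x r"
    and test: "\<And>i. \<phi> i \<in> test_functions"
    unfolding test_null_def by blast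
  obtain N where N: "2 powi (- int N) < r"
    using exists_two_powi_less[OF r(1)] by blast
  have "depends_on_digits N (\<phi> i)" for i
    unfolding depends_on_digits_def
  proof (intro allI impI)
    fix x y assume xy: "\<forall>j<N. coord x (int j) = coord y (int j)"
    \<comment> \<open>This point differs from \<open>x\<close> by an integer shift only, and lies in
      the ball around \<open>y\<close>; it links periodicity with constancy on balls.\<close>
    define z where "z = Abs_dyadic (\<lambda>k. if k \<ge> 0 then coord x k else coord y k)"
    have "\<exists>m. \<forall>k<m. \<not> (if k \<ge> 0 then coord x k else coord y k)"
    proof -
      obtain m where "\<forall>k<m. \<not> coord y k"
        using coord_bounded_below by blast
      then show ?thesis
        by (intro exI[of _ "min m 0"]) auto
    qed
    then have z: "coord z k \<longleftrightarrow> (if k \<ge> 0 then coord x k else coord y k)" for k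
      unfolding z_def by (subst Abs_dyadic_inverse) auto
    have "\<phi> i x = \<phi> i z"
      by (rule periodic1_cong) (use test[of i] in \<open>auto simp: test_functions_def z\<close>)
    moreover have "z \<in> cyl (int N) y"
    proof -
      have "coord z k = coord y k" if "k < int N" for k
        using xy[rule_format, of "nat k"] that by (auto simp: z)
      then show ?thesis
        by (simp add: cyl_def)
    qed
    then have "z \<in> ball y r" "y \<in> ball y r"
      using N r(1) by (auto simp: cyl_eq_ball)
    then have "\<phi> i z = \<phi> i y"
      using r(2)[of i y] unfolding constant_on_def by force
    ultimately show "\<phi> i x = \<phi> i y"
      by simp
  qed
  then have "(\<lambda>i. walsh_series c (\<phi> i)) = (\<lambda>i. \<Sum>n<2 ^ N. c n * walsh_hat (\<phi> i) n)"
    by (intro ext walsh_series_eq)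
  moreover have "(\<lambda>i. \<Sum>n<2 ^ N. c n * walsh_hat (\<phi> i) n) \<longlonglongrightarrow> (\<Sum>n<2 ^ N. c n * 0)"
    by (intro tendsto_intros walsh_hat_null null)
  ultimately show "(\<lambda>i. walsh_series c (\<phi> i)) \<longlonglongrightarrow> 0"
    by simp
qed

text \<open>Differentiating the test function twice multiplies its coefficients by n^2, and in the
  pairing this factor can be moved to the coefficients of the distribution.\<close>

lemma gibbs_dist_walsh_series: "gibbs_dist 2 (walsh_series c) = walsh_series (\<lambda>n. (of_nat n)\<^sup>2 * c n)"
proof (rule extensionalityI)
  show "gibbs_dist 2 (walsh_series c) \<in> extensional test_functions"
    "walsh_series (\<lambda>n. (of_nat n)\<^sup>2 * c n) \<in> extensional test_functions"
    by (simp_all add: gibbs_dist_def walsh_series_def)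
  fix \<phi> assume \<phi>: "\<phi> \<in> test_functions"
  then obtain N where N: "depends_on_digits N \<phi>"
    unfolding test_functions_iff by blast
  let ?\<psi> = "\<lambda>x. \<Sum>n<2 ^ N. (of_nat n)\<^sup>2 * walsh_hat \<phi> n * walsh n x"
  have "(gibbs ^^ 2) \<phi> = ?\<psi>"
    by (subst walsh_expansion(1)[OF N]) (rule gibbs_gibbs_walsh_sum)
  then have "gibbs_dist 2 (walsh_series c) \<phi> = walsh_series c ?\<psi>"
    using \<phi> by (simp add: gibbs_dist_def)
  also have "\<dots> = (\<Sum>n<2 ^ N. c n * ((of_nat n)\<^sup>2 * walsh_hat \<phi> n))"
    unfolding walsh_series_eq[OF depends_on_digits_walsh_sum]
    by (rule sum.cong) (simp_all add: walsh_hat_sum)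
  also have "\<dots> = walsh_series (\<lambda>n. (of_nat n)\<^sup>2 * c n) \<phi>"
    by (simp add: walsh_series_eq[OF N] ac_simps)
  finally show "gibbs_dist 2 (walsh_series c) \<phi> = walsh_series (\<lambda>n. (of_nat n)\<^sup>2 * c n) \<phi>" .
qed

lemma distribution_eq_walsh_series: "F \<in> distributions \<Longrightarrow> F = walsh_series (walsh_coeff F)"
  by (rule distribution_eqI) (simp_all add: walsh_series_distribution)

lemma walsh_coeff_gibbs_dist:
  "F \<in> distributions \<Longrightarrow> walsh_coeff (gibbs_dist 2 F) n = (of_nat n)\<^sup>2 * walsh_coeff F n"
  using gibbs_dist_walsh_series[of "walsh_coeff F"] distribution_eq_walsh_series[of F] by simp

section \<open>Absolutely convergent Walsh series\<close>

text \<open>The pointwise counterpart of the formal \<open>walsh_series\<close>;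
  \<open>dist_of_walsh_fun\<close> identifies the two under absolute summability.\<close>

definition walsh_fun :: "(nat \<Rightarrow> complex) \<Rightarrow> dyadic \<Rightarrow> complex" where
  "walsh_fun c x = (\<Sum>n. c n * walsh n x)"

context
  fixes c :: "nat \<Rightarrow> complex"
  assumes c: "summable (\<lambda>n. norm (c n))"
begin

lemma summable_walsh_fun: "summable (\<lambda>n. norm (c n * walsh n x))"
  using c by (simp add: norm_mult)

lemma norm_walsh_fun_le: "norm (walsh_fun c x) \<le> (\<Sum>n. norm (c n))"
  unfolding walsh_fun_def using summable_norm[OF summable_walsh_fun, of x] by (simp add: norm_mult)

lemma continuous_walsh_fun: "continuous_on UNIV (walsh_fun c)"
proof -
  have "uniform_limit UNIV (\<lambda>N x. \<Sum>n<N. c n * walsh n x) (\<lambda>x. \<Sum>n. c n * walsh n x) sequentially"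
    by (rule Weierstrass_m_test[OF _ c]) (simp add: norm_mult)
  then have "continuous_on UNIV (\<lambda>x. \<Sum>n. c n * walsh n x)"
    by (rule uniform_limit_theorem[rotated])
      (auto intro!: always_eventually continuous_intros continuous_walsh)
  then show ?thesis
    by (simp add: walsh_fun_def[abs_def])
qed

lemma periodic1_walsh_fun: "periodic1 (walsh_fun c)"
proof -
  have "periodic1 (walsh n)" for n
    using walsh_test_function unfolding test_functions_def by blast
  then show ?thesis
    by (simp add: periodic1_def walsh_fun_def)
qed

text \<open>Termwise integration is justified because the integrals of the norms are the summable
  \<open>norm (c n)\<close>; orthonormality leaves one term.\<close>

lemma walsh_hat_walsh_fun: "walsh_hat (walsh_fun c) m = c m"
proof -
  let ?f = "\<lambda>n x. c n * walsh n x * walsh m x"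
  have int: "integrable unit_haar (?f n)" for n
    by (rule integrable_unit[where B = "norm (c n)"])
      (auto intro!: continuous_intros continuous_walsh simp: norm_mult)
  have "walsh_fun c x * walsh m x = (\<Sum>n. ?f n x)" for x
    unfolding walsh_fun_def by (rule suminf_mult2[OF summable_norm_cancel[OF summable_walsh_fun]])
  then have "walsh_hat (walsh_fun c) m = (\<integral>x. (\<Sum>n. ?f n x) \<partial>unit_haar)"
    by (simp add: walsh_hat_def)
  also have "\<dots> = (\<Sum>n. integral\<^sup>L unit_haar (?f n))"
    by (rule integral_suminf) (simp_all add: int norm_mult c measure_unit_haar)
  also have "\<dots> = (\<Sum>n. if n = m then c n else 0)"
    by (simp add: mult.assoc walsh_orthonormal if_distrib cong: if_cong)
  also have "\<dots> = c m"
    by (rule sums_unique[symmetric]) (rule sums_single)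
  finally show ?thesis .
qed

lemma walsh_fun_CP: "walsh_fun c \<in> CP"
  by (simp add: CP_def periodic1_walsh_fun continuous_walsh_fun)

lemma walsh_fun_L2P: "walsh_fun c \<in> L2P"
proof -
  have [measurable]: "walsh_fun c \<in> borel_measurable borel"
    using borel_measurable_continuous_onI[OF continuous_walsh_fun] .
  \<comment> \<open>The real integrand is embedded into the complex numbers so that
    \<open>integrable_unit\<close> applies.\<close>
  have "integrable unit_haar (\<lambda>x. of_real ((norm (walsh_fun c x))\<^sup>2) :: complex)"
    by (rule integrable_unit[where B = "(\<Sum>n. norm (c n))\<^sup>2"])
      (auto intro!: continuous_intros continuous_walsh_fun power_mono norm_walsh_fun_le simp: norm_power)
  then have "integrable unit_haar (\<lambda>x. (norm (walsh_fun c x))\<^sup>2)"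
    by (simp only: complex_of_real_integrable_eq)
  then have "set_integrable haar I_unit (\<lambda>x. (norm (walsh_fun c x))\<^sup>2)"
    unfolding set_integrable_def by (subst (asm) integrable_restrict_space) simp_all
  then show ?thesis
    by (simp add: L2P_def periodic1_walsh_fun set_borel_measurable_def)
qed

text \<open>Expanding the test function into a finite Walsh sum reduces the pairing to the
  coefficients of \<open>walsh_fun c\<close>, which are the given ones.\<close>

lemma dist_of_walsh_fun: "dist_of_fun (walsh_fun c) = walsh_series c"
proof (rule extensionalityI)
  show "dist_of_fun (walsh_fun c) \<in> extensional test_functions"
    "walsh_series c \<in> extensional test_functions"
    by (simp_all add: dist_of_fun_def walsh_series_def)
  fix \<phi> assume \<phi>: "\<phi> \<in> test_functions"
  then obtain N where N: "depends_on_digits N \<phi>"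
    unfolding test_functions_iff by blast
  have int: "integrable unit_haar (\<lambda>x. walsh_fun c x * walsh n x)" for n
    by (rule integrable_unit[where B = "\<Sum>n. norm (c n)"])
      (auto intro!: continuous_intros continuous_walsh continuous_walsh_fun norm_walsh_fun_le simp: norm_mult)
  have "walsh_fun c x * \<phi> x = (\<Sum>n<2 ^ N. walsh_hat \<phi> n * (walsh_fun c x * walsh n x))" for x
    by (subst walsh_expansion(1)[OF N]) (simp add: sum_distrib_left ac_simps)
  then have "dist_of_fun (walsh_fun c) \<phi>
      = (\<integral>x. (\<Sum>n<2 ^ N. walsh_hat \<phi> n * (walsh_fun c x * walsh n x)) \<partial>unit_haar)"
    using \<phi> by (simp add: dist_of_fun_def set_integral_unit)
  also have "\<dots> = (\<Sum>n<2 ^ N. walsh_hat \<phi> n * walsh_hat (walsh_fun c) n)"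
    unfolding walsh_hat_def[of "walsh_fun c"]
    by (subst Bochner_Integration.integral_sum) (auto simp: int)
  also have "\<dots> = walsh_series c \<phi>"
    by (simp add: walsh_hat_walsh_fun walsh_series_eq[OF N] mult.commute)
  finally show "dist_of_fun (walsh_fun c) \<phi> = walsh_series c \<phi>" .
qed

end

section \<open>The equation for the coefficients\<close>

text \<open>Multiplication by the integrating factor exp(-a t) gives a function with zero derivative
  on a convex set, hence constant.\<close>

lemma linear_ode_zero:
  fixes y :: "real \<Rightarrow> complex"
  assumes U: "convex U" "0 \<in> U"
    and y: "\<And>t. t \<in> U \<Longrightarrow> (y has_vector_derivative of_real a * y t) (at t within U)"
    and "y 0 = 0" and t: "t \<in> U"
  shows "y t = 0"
proof -
  define z where "z t = y t * of_real (exp (- a * t))" for t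
  have "(z has_vector_derivative 0) (at t within U)" if "t \<in> U" for t
  proof -
    have "((\<lambda>t. exp (- a * t)) has_real_derivative (- a * exp (- a * t))) (at t within U)"
      by (auto intro!: derivative_eq_intros)
    then have "((\<lambda>t. complex_of_real (exp (- a * t))) has_vector_derivative
        of_real (- a * exp (- a * t))) (at t within U)"
      by (rule has_vector_derivative_of_real)
    from has_vector_derivative_mult[OF y[OF that] this] show ?thesis
      by (simp add: z_def[abs_def] algebra_simps)
  qed
  then have "\<exists>k. \<forall>t\<in>U. z t = k"
    using has_vector_derivative_zero_constant[OF U(1)] by metis
  then have "z t = z 0"
    using U(2) t by metis
  then show ?thesis
    using \<open>y 0 = 0\<close> by (simp add: z_def)
qed

text \<open>The equation \<open>c'' = a\<^sup>2 c\<close> splits into \<open>(c' - a c)' = - a (c' - a c)\<close> and \<open>c' = a c\<close>.\<close>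

lemma second_order_ode_zero:
  fixes c c' :: "real \<Rightarrow> complex"
  assumes U: "convex U" "0 \<in> U"
    and c: "\<And>t. t \<in> U \<Longrightarrow> (c has_vector_derivative c' t) (at t within U)"
    and c': "\<And>t. t \<in> U \<Longrightarrow> (c' has_vector_derivative (of_real a)\<^sup>2 * c t) (at t within U)"
    and init: "c 0 = 0" "c' 0 = 0" and t: "t \<in> U"
  shows "c t = 0"
proof -
  have "c' t - of_real a * c t = 0" if "t \<in> U" for t
  proof (rule linear_ode_zero[OF U _ _ that, of "\<lambda>t. c' t - of_real a * c t" "- a"])
    fix t assume "t \<in> U"
    have "((\<lambda>t. c' t - of_real a * c t) has_vector_derivative
        (of_real a)\<^sup>2 * c t - of_real a * c' t) (at t within U)"
      by (intro has_vector_derivative_diff has_vector_derivative_mult_right c c' \<open>t \<in> U\<close>)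
    then show "((\<lambda>t. c' t - of_real a * c t) has_vector_derivative
        of_real (- a) * (c' t - of_real a * c t)) (at t within U)"
      by (simp add: algebra_simps power2_eq_square)
  qed (simp add: init)
  then have "(c has_vector_derivative of_real a * c t) (at t within U)" if "t \<in> U" for t
    using c[OF that] that by simp
  from linear_ode_zero[OF U this init(1) t] show ?thesis .
qed

text \<open>Each coefficient of the difference of two solutions solves c'' = n^2 c with zero initial
  data, and coefficients determine a distribution.\<close>

lemma cauchy_solution_unique:
  assumes U: "convex U" "0 \<in> U"
    and f: "cauchy_solution U f0 f1 f" and g: "cauchy_solution U f0 f1 g" and t: "t \<in> U"
  shows "g t = f t"
proof (rule distribution_eqI)
  obtain f' f'' where f':
    "\<And>t. t \<in> U \<Longrightarrow> has_weak_derivative f (f' t) t U"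
    "\<And>t. t \<in> U \<Longrightarrow> has_weak_derivative f' (f'' t) t U"
    "\<And>t. t \<in> U \<Longrightarrow> f'' t = gibbs_dist 2 (f t)" "f 0 = f0" "f' 0 = f1"
    using f unfolding cauchy_solution_def by blast
  obtain g' g'' where g':
    "\<And>t. t \<in> U \<Longrightarrow> has_weak_derivative g (g' t) t U"
    "\<And>t. t \<in> U \<Longrightarrow> has_weak_derivative g' (g'' t) t U"
    "\<And>t. t \<in> U \<Longrightarrow> g'' t = gibbs_dist 2 (g t)" "g 0 = f0" "g' 0 = f1"
    using g unfolding cauchy_solution_def by blast
  have dist: "f t \<in> distributions" "g t \<in> distributions" if "t \<in> U" for t
    using f g that by (auto simp: cauchy_solution_def)
  show "g t \<in> distributions" "f t \<in> distributions"
    using dist t by auto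
  fix n
  define c where "c s = walsh_coeff (g s) n - walsh_coeff (f s) n" for s
  define c' where "c' s = walsh_coeff (g' s) n - walsh_coeff (f' s) n" for s
  have "c t = 0"
  proof (rule second_order_ode_zero[OF U, of c c' "real n"])
    fix s assume s: "s \<in> U"
    show "(c has_vector_derivative c' s) (at s within U)"
      unfolding c_def[abs_def] c'_def
      using f'(1)[OF s] g'(1)[OF s]
      by (intro has_vector_derivative_diff) (simp_all add: has_weak_derivative_def)
    have "(c' has_vector_derivative walsh_coeff (g'' s) n - walsh_coeff (f'' s) n) (at s within U)"
      unfolding c'_def[abs_def]
      using f'(2)[OF s] g'(2)[OF s]
      by (intro has_vector_derivative_diff) (simp_all add: has_weak_derivative_def)
    then show "(c' has_vector_derivative (of_real (real n))\<^sup>2 * c s) (at s within U)"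
      by (simp add: f'(3) g'(3) s walsh_coeff_gibbs_dist dist c_def right_diff_distrib)
  qed (simp_all add: c_def c'_def f' g' t)
  then show "walsh_coeff (g t) n = walsh_coeff (f t) n"
    by (simp add: c_def)
qed

text \<open>The limit \<open>t\<close> of \<open>sinh (a t) / a\<close> as \<open>a\<close> tends to 0 replaces the junk value at \<open>a = 0\<close>.\<close>

definition sinh_div :: "real \<Rightarrow> real \<Rightarrow> real" where
  "sinh_div a t = (if a = 0 then t else sinh (a * t) / a)"

section \<open>The explicit solution\<close>

definition wave_coeff :: "(nat \<Rightarrow> complex) \<Rightarrow> (nat \<Rightarrow> complex) \<Rightarrow> real \<Rightarrow> nat \<Rightarrow> complex" where
  "wave_coeff p q t n = p n * of_real (cosh (real n * t)) + q n * of_real (sinh_div (real n) t)"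

definition wave_coeff' :: "(nat \<Rightarrow> complex) \<Rightarrow> (nat \<Rightarrow> complex) \<Rightarrow> real \<Rightarrow> nat \<Rightarrow> complex" where
  "wave_coeff' p q t n =
     p n * of_real (real n * sinh (real n * t)) + q n * of_real (cosh (real n * t))"

lemma sinh_div_deriv: "(sinh_div a has_real_derivative cosh (a * t)) (at t within U)"
  unfolding sinh_div_def[abs_def]
  by (cases "a = 0") (auto intro!: derivative_eq_intros)

lemma wave_coeff_deriv:
  "((\<lambda>t. wave_coeff p q t n) has_vector_derivative wave_coeff' p q t n) (at t within U)"
  unfolding wave_coeff_def wave_coeff'_def
  by (intro has_vector_derivative_add has_vector_derivative_mult_right has_vector_derivative_of_real sinh_div_deriv)
    (auto intro!: derivative_eq_intros)

lemma wave_coeff'_deriv: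
  "((\<lambda>t. wave_coeff' p q t n) has_vector_derivative (of_nat n)\<^sup>2 * wave_coeff p q t n) (at t within U)"
proof -
  have "((\<lambda>t. wave_coeff' p q t n) has_vector_derivative
      p n * of_real (real n * (real n * cosh (real n * t))) + q n * of_real (real n * sinh (real n * t)))
      (at t within U)"
    unfolding wave_coeff'_def
    by (intro has_vector_derivative_add has_vector_derivative_mult_right has_vector_derivative_of_real)
      (auto intro!: derivative_eq_intros)
  moreover have "p n * of_real (real n * (real n * cosh (real n * t))) + q n * of_real (real n * sinh (real n * t))
      = (of_nat n)\<^sup>2 * wave_coeff p q t n"
    \<comment> \<open>For positive \<open>n\<close> the factor n^2 cancels the divisor in
      \<open>sinh_div\<close>; at \<open>n = 0\<close> both sides vanish.\<close>
    by (cases "n = 0") (simp_all add: wave_coeff_def sinh_div_def field_simps power2_eq_square)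
  ultimately show ?thesis
    by simp
qed

text \<open>Every condition is coefficientwise and every sequence defines a distribution, so no
  convergence question arises.\<close>

lemma wave_series_solution:
  assumes "f0 \<in> distributions" "f1 \<in> distributions"
    and p: "\<And>n. p n = walsh_coeff f0 n" and q: "\<And>n. q n = walsh_coeff f1 n"
  shows "cauchy_solution U f0 f1 (\<lambda>t. walsh_series (wave_coeff p q t))"
  unfolding cauchy_solution_def
proof (intro conjI exI ballI)
  fix t
  show "has_weak_derivative (\<lambda>t. walsh_series (wave_coeff p q t))
      (walsh_series (wave_coeff' p q t)) t U"
    by (simp add: has_weak_derivative_def wave_coeff_deriv)
  show "has_weak_derivative (\<lambda>t. walsh_series (wave_coeff' p q t))
      (walsh_series (\<lambda>n. (of_nat n)\<^sup>2 * wave_coeff p q t n)) t U"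
    by (simp add: has_weak_derivative_def wave_coeff'_deriv)
  show "walsh_series (\<lambda>n. (of_nat n)\<^sup>2 * wave_coeff p q t n)
      = gibbs_dist 2 (walsh_series (wave_coeff p q t))"
    by (simp add: gibbs_dist_walsh_series)
next
  show "walsh_series (wave_coeff p q 0) = f0"
    by (rule distribution_eqI) (simp_all add: walsh_series_distribution assms(1) wave_coeff_def
        sinh_div_def p)
  show "walsh_series (wave_coeff' p q 0) = f1"
    by (rule distribution_eqI) (simp_all add: walsh_series_distribution assms(2) wave_coeff'_def q)
qed (rule walsh_series_distribution)+

section \<open>Growth of the coefficients and summability\<close>

lemma wave_coeff_bound:
  assumes "t \<ge> 0" "n \<ge> 1"
  shows "norm (wave_coeff p q t n) \<le> (norm (p n) + norm (q n)) * exp (real n * t)"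
proof -
  have nt: "real n * t \<ge> 0"
    using assms by simp
  have cosh: "\<bar>cosh (real n * t)\<bar> \<le> exp (real n * t)"
    using nt by (simp add: cosh_field_def)
  \<comment> \<open>Here \<open>n \<ge> 1\<close> absorbs the divisor. At \<open>n = 0\<close> the
    value is \<open>t\<close>, which exp(0) does not dominate for large \<open>t\<close>.\<close>
  have sinh: "\<bar>sinh_div (real n) t\<bar> \<le> exp (real n * t)"
  proof -
    have "\<bar>sinh_div (real n) t\<bar> = sinh (real n * t) / real n"
      using assms nt by (simp add: sinh_div_def)
    also have "\<dots> \<le> sinh (real n * t) / 1"
      using assms nt by (intro divide_left_mono) auto
    also have "\<dots> \<le> exp (real n * t)"
      by (simp add: sinh_field_def) (smt (verit) exp_gt_zero)
    finally show ?thesis .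
  qed
  have "norm (wave_coeff p q t n)
      \<le> norm (p n) * \<bar>cosh (real n * t)\<bar> + norm (q n) * \<bar>sinh_div (real n) t\<bar>"
    unfolding wave_coeff_def by (rule norm_triangle_le) (simp add: norm_mult)
  also have "\<dots> \<le> norm (p n) * exp (real n * t) + norm (q n) * exp (real n * t)"
    using cosh sinh by (intro add_mono mult_left_mono) auto
  finally show ?thesis
    by (simp add: distrib_right)
qed

lemma summable_wave_coeff:
  assumes \<theta>: "filterlim \<theta> at_top sequentially"
    and p: "p \<in> O(\<lambda>n. of_real (exp (- real n * \<theta> n)))"
    and q: "q \<in> O(\<lambda>n. of_real (exp (- real n * \<theta> n)))" and t: "t \<ge> 0"
  shows "summable (\<lambda>n. norm (wave_coeff p q t n))"
proof -
  from p obtain C where C: "C > 0" "\<forall>\<^sub>F n in sequentially. norm (p n) \<le> C * exp (- real n * \<theta> n)"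
    by (elim landau_o.bigE) simp
  from q obtain D where D: "D > 0" "\<forall>\<^sub>F n in sequentially. norm (q n) \<le> D * exp (- real n * \<theta> n)"
    by (elim landau_o.bigE) simp
  \<comment> \<open>With the margin 1 the exponent n (t - \<open>\<theta> n\<close>) is at most -n,
    so the coefficients are eventually dominated by a geometric series of ratio exp(-1).\<close>
  have \<theta>_ge: "\<forall>\<^sub>F n in sequentially. t + 1 \<le> \<theta> n"
    using \<theta> by (simp add: filterlim_at_top)
  have "\<forall>\<^sub>F n in sequentially. norm (norm (wave_coeff p q t n)) \<le> (C + D) * exp (- 1) ^ n"
    using C(2) D(2) \<theta>_ge eventually_ge_at_top[of 1]
  proof eventually_elim
    case (elim n)
    have "norm (wave_coeff p q t n) \<le> (norm (p n) + norm (q n)) * exp (real n * t)"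
      using t elim by (intro wave_coeff_bound)
    also have "\<dots> \<le> ((C + D) * exp (- real n * \<theta> n)) * exp (real n * t)"
      using elim by (intro mult_right_mono) (auto simp: distrib_right)
    also have "\<dots> = (C + D) * exp (real n * (t - \<theta> n))"
      by (simp add: right_diff_distrib flip: exp_add)
    also have "\<dots> \<le> (C + D) * exp (real n * (- 1))"
      using C(1) D(1) elim by (intro mult_left_mono iffD2[OF exp_le_cancel_iff]) auto
    also have "exp (real n * (- 1)) = exp (- 1 :: real) ^ n"
      by (rule exp_of_nat_mult)
    finally show ?case
      by simp
  qed
  then show ?thesis
    by (rule summable_comparison_test_ev) (intro summable_mult summable_geometric, simp)
qed

theorem theorem3:
  fixes U :: "real set" and f0 f1 :: functional and p q :: "nat \<Rightarrow> complex"
  assumes U: "U = {0..} \<or> (\<exists>T>0. U = {0..T})"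
    and f0: "f0 \<in> distributions" and f1: "f1 \<in> distributions"
    and p: "\<And>n. p n = walsh_coeff f0 n" and q: "\<And>n. q n = walsh_coeff f1 n"
  shows "\<exists>f. cauchy_solution U f0 f1 f \<and>
    (\<forall>g. cauchy_solution U f0 f1 g \<longrightarrow> (\<forall>t\<in>U. g t = f t)) \<and>
    (\<forall>\<theta> :: nat \<Rightarrow> real. filterlim \<theta> at_top sequentially \<longrightarrow>
       p \<in> O(\<lambda>n. of_real (exp (- real n * \<theta> n))) \<longrightarrow>
       q \<in> O(\<lambda>n. of_real (exp (- real n * \<theta> n))) \<longrightarrow>
       (\<forall>t\<in>U. \<exists>u\<in>CP. f t = dist_of_fun u)) \<and>
    (\<forall>\<theta> :: nat \<Rightarrow> real. filterlim \<theta> at_top sequentially \<longrightarrow>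
       p \<in> O(\<lambda>n. of_real (exp (- real n * \<theta> n))) \<longrightarrow>
       q \<in> O(\<lambda>n. of_real (exp (- real n * \<theta> n))) \<longrightarrow>
       (\<forall>t\<in>U. \<exists>u\<in>L2P. f t = dist_of_fun u))"
proof (intro exI conjI allI impI ballI)
  have U': "convex U" "0 \<in> U" and nonneg: "\<And>t. t \<in> U \<Longrightarrow> t \<ge> 0"
    using U by (auto intro: less_imp_le)
  let ?f = "\<lambda>t. walsh_series (wave_coeff p q t)"
  show sol: "cauchy_solution U f0 f1 ?f"
    by (rule wave_series_solution[OF f0 f1 p q])
  show "g t = ?f t" if "cauchy_solution U f0 f1 g" "t \<in> U" for g t
    using cauchy_solution_unique[OF U' sol that] .
  fix \<theta> :: "nat \<Rightarrow> real" and t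
  assume "filterlim \<theta> at_top sequentially" "p \<in> O(\<lambda>n. of_real (exp (- real n * \<theta> n)))"
    "q \<in> O(\<lambda>n. of_real (exp (- real n * \<theta> n)))" "t \<in> U"
  \<comment> \<open>One summability fact at the fixed time serves both spaces: the same
    \<open>walsh_fun\<close> is continuous and square integrable.\<close>
  then have summable: "summable (\<lambda>n. norm (wave_coeff p q t n))"
    by (intro summable_wave_coeff nonneg)
  then show "\<exists>u\<in>CP. ?f t = dist_of_fun u"
    using dist_of_walsh_fun walsh_fun_CP by metis
  show "\<exists>u\<in>L2P. ?f t = dist_of_fun u"
    using dist_of_walsh_fun[OF summable] walsh_fun_L2P[OF summable] by metis
qed

end
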